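(* Let $\kappa\geq\aleph_0$ be a cardinal. Suppose that $E$ is a $\kappa$-complete but not $\kappa^+$-complete ultrafilter on a set $I$, and that $M_1$ is a $\kappa^+$-saturated model in which a linear order $L$ and a tree $T$ are interpreted. Then in $M_2 = M_1^I/E$: (a) the linear order $L^{M_2}$ has no $(\kappa,\kappa)$-cut, and moreover no $(\theta,\sigma)$-cut for $\theta,\sigma<\kappa$ both regular; (b) the tree $T^{M_2}$ has no branch (i.e. maximal linearly ordered set) of cofinality $\leq\kappa$.
   Context: All languages are countable. An ultrafilter is $\mu$-complete if the intersection of any fewer than $\mu$ of its members is again a member. A $(\kappa_1,\kappa_2)$-cut in a linear order $L$ consists of a strictly increasing sequence $\langle a_i : i<\kappa_1\rangle$ and a strictly decreasing sequence $\langle b_j: j<\kappa_2\rangle$ of elements of $L$ with $a_i<b_j$ for all $i<\kappa_1$, $j<\kappa_2$, such that no $x\in L$ satisfies $a_i<x<b_j$ for all $i<\kappa_1$, $j<\kappa_2$. A tree here is a partial order in which the set of predecessors of each element is linearly ordered.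
   Formalization: In (b) only branches of infinite cofinality (no last element) are excluded, since a branch with a last element has cofinality 1 and can exist (e.g. in a one-element tree); in (a) "regular" means infinite regular. *)

theory Defs
  imports Main "HOL-Library.FuncSet" "HOL-Library.Countable_Set"
begin

unbundle cardinal_syntax

subsection \<open>First-order logic\<close>

text \<open>A symbol of a language is a name paired with its arity.\<close>

record ('f, 'r) lang =
  funs :: "('f \<times> nat) set"
  rels :: "('r \<times> nat) set"

definition countable_lang :: "('f, 'r) lang \<Rightarrow> bool" where
  "countable_lang Lg \<longleftrightarrow> countable (funs Lg) \<and> countable (rels Lg)"

datatype 'f tm = Var nat | Fn 'f "'f tm list"

datatype ('f, 'r) fm =
    Eq "'f tm" "'f tm"
  | Rel 'r "'f tm list"
  | Neg "('f, 'r) fm"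
  | Conj "('f, 'r) fm" "('f, 'r) fm"
  | Ex nat "('f, 'r) fm"

fun wf_tm :: "('f, 'r) lang \<Rightarrow> 'f tm \<Rightarrow> bool" where
  "wf_tm Lg (Var n) \<longleftrightarrow> True"
| "wf_tm Lg (Fn f ts) \<longleftrightarrow> (f, length ts) \<in> funs Lg \<and> (\<forall>t\<in>set ts. wf_tm Lg t)"

fun wf_fm :: "('f, 'r) lang \<Rightarrow> ('f, 'r) fm \<Rightarrow> bool" where
  "wf_fm Lg (Eq s t) \<longleftrightarrow> wf_tm Lg s \<and> wf_tm Lg t"
| "wf_fm Lg (Rel R ts) \<longleftrightarrow> (R, length ts) \<in> rels Lg \<and> (\<forall>t\<in>set ts. wf_tm Lg t)"
| "wf_fm Lg (Neg \<phi>) \<longleftrightarrow> wf_fm Lg \<phi>"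
| "wf_fm Lg (Conj \<phi> \<psi>) \<longleftrightarrow> wf_fm Lg \<phi> \<and> wf_fm Lg \<psi>"
| "wf_fm Lg (Ex n \<phi>) \<longleftrightarrow> wf_fm Lg \<phi>"

fun fv_tm :: "'f tm \<Rightarrow> nat set" where
  "fv_tm (Var n) = {n}"
| "fv_tm (Fn f ts) = (\<Union>t\<in>set ts. fv_tm t)"

fun fv :: "('f, 'r) fm \<Rightarrow> nat set" where
  "fv (Eq s t) = fv_tm s \<union> fv_tm t"
| "fv (Rel R ts) = (\<Union>t\<in>set ts. fv_tm t)"
| "fv (Neg \<phi>) = fv \<phi>"
| "fv (Conj \<phi> \<psi>) = fv \<phi> \<union> fv \<psi>"
| "fv (Ex n \<phi>) = fv \<phi> - {n}"

text \<open>
  Only the values of the interpretations on lists over the universe, of a length allowed by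
  the language, are relevant.
\<close>

record ('f, 'r, 'a) struct =
  univ :: "'a set"
  fun_int :: "'f \<Rightarrow> 'a list \<Rightarrow> 'a"
  rel_int :: "'r \<Rightarrow> 'a list \<Rightarrow> bool"

definition is_struct :: "('f, 'r) lang \<Rightarrow> ('f, 'r, 'a) struct \<Rightarrow> bool" where
  "is_struct Lg M \<longleftrightarrow> univ M \<noteq> {} \<and>
     (\<forall>(f, n)\<in>funs Lg. \<forall>xs. length xs = n \<and> set xs \<subseteq> univ M \<longrightarrow> fun_int M f xs \<in> univ M)"

fun eval :: "('f, 'r, 'a) struct \<Rightarrow> (nat \<Rightarrow> 'a) \<Rightarrow> 'f tm \<Rightarrow> 'a" where
  "eval M e (Var n) = e n"
| "eval M e (Fn f ts) = fun_int M f (map (eval M e) ts)"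

fun sat :: "('f, 'r, 'a) struct \<Rightarrow> (nat \<Rightarrow> 'a) \<Rightarrow> ('f, 'r) fm \<Rightarrow> bool" where
  "sat M e (Eq s t) \<longleftrightarrow> eval M e s = eval M e t"
| "sat M e (Rel R ts) \<longleftrightarrow> rel_int M R (map (eval M e) ts)"
| "sat M e (Neg \<phi>) \<longleftrightarrow> \<not> sat M e \<phi>"
| "sat M e (Conj \<phi> \<psi>) \<longleftrightarrow> sat M e \<phi> \<and> sat M e \<psi>"
| "sat M e (Ex n \<phi>) \<longleftrightarrow> (\<exists>x\<in>univ M. sat M (e(n := x)) \<phi>)"

text \<open>
  A formula with parameters from A and the single free variable 0 is encoded as a pair
  of a formula and an assignment that sends its free variables other than 0 to the parameters.
  A structure is \<mu>-saturated if every finitely satisfiable set of such formulas, over fewer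
  than \<mu> parameters, is realised by a single element.
\<close>

definition saturated :: "('f, 'r) lang \<Rightarrow> ('f, 'r, 'a) struct \<Rightarrow> 'k rel \<Rightarrow> bool" where
  "saturated Lg M \<mu> \<longleftrightarrow>
     (\<forall>A p. A \<subseteq> univ M \<and> |A| <o \<mu> \<and>
        (\<forall>(\<phi>, e)\<in>p. wf_fm Lg \<phi> \<and> e ` (fv \<phi> - {0}) \<subseteq> A) \<and>
        (\<forall>q. finite q \<and> q \<subseteq> p \<longrightarrow> (\<exists>x\<in>univ M. \<forall>(\<phi>, e)\<in>q. sat M (e(0 := x)) \<phi>)) \<longrightarrow>
        (\<exists>x\<in>univ M. \<forall>(\<phi>, e)\<in>p. sat M (e(0 := x)) \<phi>))"


subsection \<open>Ultrafilters and ultrapowers\<close>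

definition ultrafilter_on :: "'i set \<Rightarrow> 'i set set \<Rightarrow> bool" where
  "ultrafilter_on I E \<longleftrightarrow>
     E \<subseteq> Pow I \<and> I \<in> E \<and> {} \<notin> E \<and>
     (\<forall>X\<in>E. \<forall>Y\<in>E. X \<inter> Y \<in> E) \<and>
     (\<forall>X\<in>E. \<forall>Y. X \<subseteq> Y \<and> Y \<subseteq> I \<longrightarrow> Y \<in> E) \<and>
     (\<forall>X. X \<subseteq> I \<longrightarrow> X \<in> E \<or> I - X \<in> E)"

text \<open>The intersection with I only matters for the empty family.\<close>

definition complete_on :: "'i set \<Rightarrow> 'k rel \<Rightarrow> 'i set set \<Rightarrow> bool" where
  "complete_on I \<mu> E \<longleftrightarrow> (\<forall>F. F \<subseteq> E \<and> |F| <o \<mu> \<longrightarrow> I \<inter> \<Inter>F \<in> E)"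

definition up_rel :: "'i set \<Rightarrow> 'i set set \<Rightarrow> ('f, 'r, 'a) struct \<Rightarrow> ('i \<Rightarrow> 'a) rel" where
  "up_rel I E M = {(g, h). g \<in> I \<rightarrow>\<^sub>E univ M \<and> h \<in> I \<rightarrow>\<^sub>E univ M \<and> {t \<in> I. g t = h t} \<in> E}"

definition up_class ::
    "'i set \<Rightarrow> 'i set set \<Rightarrow> ('f, 'r, 'a) struct \<Rightarrow> ('i \<Rightarrow> 'a) \<Rightarrow> ('i \<Rightarrow> 'a) set" where
  "up_class I E M g = up_rel I E M `` {g}"

definition up_rep :: "('i \<Rightarrow> 'a) set \<Rightarrow> 'i \<Rightarrow> 'a" where
  "up_rep X = (SOME g. g \<in> X)"

definition ultrapower ::
    "'i set \<Rightarrow> 'i set set \<Rightarrow> ('f, 'r, 'a) struct \<Rightarrow> ('f, 'r, ('i \<Rightarrow> 'a) set) struct" where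
  "ultrapower I E M =
     \<lparr>univ = (I \<rightarrow>\<^sub>E univ M) // up_rel I E M,
      fun_int = (\<lambda>f Xs. up_class I E M (\<lambda>t\<in>I. fun_int M f (map (\<lambda>X. up_rep X t) Xs))),
      rel_int = (\<lambda>R Xs. {t \<in> I. rel_int M R (map (\<lambda>X. up_rep X t) Xs)} \<in> E)\<rparr>"

definition diag :: "'i set \<Rightarrow> 'i set set \<Rightarrow> ('f, 'r, 'a) struct \<Rightarrow> 'a \<Rightarrow> ('i \<Rightarrow> 'a) set" where
  "diag I E M c = up_class I E M (\<lambda>t\<in>I. c)"


subsection \<open>Interpreted orders\<close>

text \<open>
  An interpretation, with parameters cs, of a set equipped with a reflexive order: its elements
  are classes of k-tuples satisfying dom_fm, modulo the equivalence relation defined by eq_fm.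
  The free variables of dom_fm are read off the list xs @ cs, those of eq_fm and le_fm off
  the list xs @ ys @ cs. The same formulas can then be read in an extension, with the
  images of the parameters there.
\<close>

record ('f, 'r) interp =
  dim :: nat
  dom_fm :: "('f, 'r) fm"
  eq_fm :: "('f, 'r) fm"
  le_fm :: "('f, 'r) fm"

definition env :: "'a list \<Rightarrow> nat \<Rightarrow> 'a" where
  "env xs n = (if n < length xs then xs ! n else undefined)"

definition int_dom ::
    "('f, 'r, 'a) struct \<Rightarrow> ('f, 'r) interp \<Rightarrow> 'a list \<Rightarrow> 'a list set" where
  "int_dom M \<Gamma> cs =
     {xs. length xs = dim \<Gamma> \<and> set xs \<subseteq> univ M \<and> sat M (env (xs @ cs)) (dom_fm \<Gamma>)}"

definition int_eq ::
    "('f, 'r, 'a) struct \<Rightarrow> ('f, 'r) interp \<Rightarrow> 'a list \<Rightarrow> 'a list rel" where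
  "int_eq M \<Gamma> cs =
     {(xs, ys). xs \<in> int_dom M \<Gamma> cs \<and> ys \<in> int_dom M \<Gamma> cs \<and> sat M (env (xs @ ys @ cs)) (eq_fm \<Gamma>)}"

definition int_univ ::
    "('f, 'r, 'a) struct \<Rightarrow> ('f, 'r) interp \<Rightarrow> 'a list \<Rightarrow> 'a list set set" where
  "int_univ M \<Gamma> cs = int_dom M \<Gamma> cs // int_eq M \<Gamma> cs"

definition int_le ::
    "('f, 'r, 'a) struct \<Rightarrow> ('f, 'r) interp \<Rightarrow> 'a list \<Rightarrow> 'a list set rel" where
  "int_le M \<Gamma> cs =
     {(X, Y). X \<in> int_univ M \<Gamma> cs \<and> Y \<in> int_univ M \<Gamma> cs \<and>
        (\<exists>xs\<in>X. \<exists>ys\<in>Y. sat M (env (xs @ ys @ cs)) (le_fm \<Gamma>))}"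

definition is_interp ::
    "('f, 'r) lang \<Rightarrow> ('f, 'r, 'a) struct \<Rightarrow> ('f, 'r) interp \<Rightarrow> 'a list \<Rightarrow> bool" where
  "is_interp Lg M \<Gamma> cs \<longleftrightarrow>
     set cs \<subseteq> univ M \<and>
     wf_fm Lg (dom_fm \<Gamma>) \<and> fv (dom_fm \<Gamma>) \<subseteq> {..<dim \<Gamma> + length cs} \<and>
     wf_fm Lg (eq_fm \<Gamma>) \<and> fv (eq_fm \<Gamma>) \<subseteq> {..<2 * dim \<Gamma> + length cs} \<and>
     wf_fm Lg (le_fm \<Gamma>) \<and> fv (le_fm \<Gamma>) \<subseteq> {..<2 * dim \<Gamma> + length cs} \<and>
     equiv (int_dom M \<Gamma> cs) (int_eq M \<Gamma> cs) \<and>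
     (\<forall>(xs, xs')\<in>int_eq M \<Gamma> cs. \<forall>(ys, ys')\<in>int_eq M \<Gamma> cs.
        sat M (env (xs @ ys @ cs)) (le_fm \<Gamma>) \<longleftrightarrow> sat M (env (xs' @ ys' @ cs)) (le_fm \<Gamma>))"

definition tree_on :: "'b set \<Rightarrow> 'b rel \<Rightarrow> bool" where
  "tree_on X r \<longleftrightarrow>
     partial_order_on X r \<and> (\<forall>t\<in>X. {s. (s, t) \<in> r \<and> s \<noteq> t} \<in> Chains r)"

definition interprets_linear_order ::
    "('f, 'r) lang \<Rightarrow> ('f, 'r, 'a) struct \<Rightarrow> ('f, 'r) interp \<Rightarrow> 'a list \<Rightarrow> bool" where
  "interprets_linear_order Lg M \<Gamma> cs \<longleftrightarrow>
     is_interp Lg M \<Gamma> cs \<and> linear_order_on (int_univ M \<Gamma> cs) (int_le M \<Gamma> cs)"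

definition interprets_tree ::
    "('f, 'r) lang \<Rightarrow> ('f, 'r, 'a) struct \<Rightarrow> ('f, 'r) interp \<Rightarrow> 'a list \<Rightarrow> bool" where
  "interprets_tree Lg M \<Gamma> cs \<longleftrightarrow>
     is_interp Lg M \<Gamma> cs \<and> tree_on (int_univ M \<Gamma> cs) (int_le M \<Gamma> cs)"


subsection \<open>Cuts and branches\<close>

text \<open>
  Orders r are reflexive, so the strict order is r - Id. A cardinal \<theta> is a well-order, whose
  field plays the role of the set of ordinals below \<theta>.
\<close>

definition is_cut ::
    "'b set \<Rightarrow> 'b rel \<Rightarrow> 'k rel \<Rightarrow> 'l rel \<Rightarrow> ('k \<Rightarrow> 'b) \<Rightarrow> ('l \<Rightarrow> 'b) \<Rightarrow> bool" where
  "is_cut X r \<theta> \<sigma> a b \<longleftrightarrow>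
     a ` Field \<theta> \<subseteq> X \<and> b ` Field \<sigma> \<subseteq> X \<and>
     (\<forall>(i, j)\<in>\<theta> - Id. (a i, a j) \<in> r - Id) \<and>
     (\<forall>(i, j)\<in>\<sigma> - Id. (b j, b i) \<in> r - Id) \<and>
     (\<forall>i\<in>Field \<theta>. \<forall>j\<in>Field \<sigma>. (a i, b j) \<in> r - Id) \<and>
     \<not> (\<exists>x\<in>X. \<forall>i\<in>Field \<theta>. \<forall>j\<in>Field \<sigma>. (a i, x) \<in> r - Id \<and> (x, b j) \<in> r - Id)"

definition has_cut :: "'b set \<Rightarrow> 'b rel \<Rightarrow> 'k rel \<Rightarrow> 'l rel \<Rightarrow> bool" where
  "has_cut X r \<theta> \<sigma> \<longleftrightarrow> (\<exists>a b. is_cut X r \<theta> \<sigma> a b)"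

definition is_branch :: "'b set \<Rightarrow> 'b rel \<Rightarrow> 'b set \<Rightarrow> bool" where
  "is_branch X r B \<longleftrightarrow>
     B \<subseteq> X \<and> B \<in> Chains r \<and> (\<forall>C. C \<subseteq> X \<and> C \<in> Chains r \<and> B \<subseteq> C \<longrightarrow> C = B)"

definition cofinal_in :: "'b rel \<Rightarrow> 'b set \<Rightarrow> 'b set \<Rightarrow> bool" where
  "cofinal_in r B D \<longleftrightarrow> D \<subseteq> B \<and> (\<forall>x\<in>B. \<exists>y\<in>D. (x, y) \<in> r)"

text \<open>
  With the reflexive order, a nonempty chain has cofinality 1 if it has a last element and
  infinite cofinality otherwise; the empty chain has cofinality 0.
\<close>

definition has_cofinality :: "'b rel \<Rightarrow> 'b set \<Rightarrow> 'k rel \<Rightarrow> bool" where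
  "has_cofinality r B \<theta> \<longleftrightarrow>
     Card_order \<theta> \<and>
     (\<exists>D. cofinal_in r B D \<and> |D| =o \<theta>) \<and>
     (\<forall>D. cofinal_in r B D \<longrightarrow> \<theta> \<le>o |D| )"

end

theory Submission
  imports Defs
begin

text \<open>
  The ultrapower M2 inherits the saturation of M1: every finitely satisfiable type with
  at most \<kappa> members is realized in M2. This is lemma ultrapower_realizes_types. Given
  such a type p, well-order it so that proper initial segments have fewer than
  \<kappa> members. By the theorem of Los and \<kappa>-completeness, for each member j almost all
  coordinates satisfy every finite part of the initial segment up to j. In a given coordinate
  the members j for which this is so form a finitely satisfiable type over M1, which
  is realized by saturation; choosing a realization in every coordinate gives a realization
  of p.

  The elements of the interpreted orders are classes of tuples, so this is extended from single
  elements to tuples in realizes_types_tuples. Applied to formulas that say a \<le> x or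
  x \<le> b, it shows that in an interpreted order of M2, sets A and B of size at most \<kappa> have a point
  above A and below B as soon as their finite subsets do (order_compact_interp).
  That the interpreted order is still a partial order in M2 follows from the theorem of
  Los (tuple_order_ultrapower).

  Part (a): for a cut with both sides of length at most \<kappa>, the finite subsets of the two sides
  are separated by a member of the lower side, so some x fills the cut.
  Part (b): a branch with a cofinal set of size at most \<kappa> has an upper bound in the tree, because
  finite subsets of a chain have one in the chain. By maximality this bound is
  the last element of the branch, so the cofinality is not infinite.
\<close>


section \<open>Finite subsets and cardinals\<close>

lemma finite_ordLess_Cinfinite:
  assumes "Cinfinite \<kappa>" "finite A"
  shows "|A| <o \<kappa>"
  using assms
  by (auto intro!: finite_ordLess_infinite
    simp: cinfinite_def card_of_well_order_on Field_card_of card_order_on_def)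

text \<open>
  The n-th iterate of inserting one more element of A contains the subsets with exactly n elements,
  and each iterate costs one product with A.
\<close>

lemma card_of_Fpow_le:
  assumes \<kappa>: "Cinfinite \<kappa>" and A: "|A| \<le>o \<kappa>"
  shows "|Fpow A| \<le>o \<kappa>"
proof -
  have inf: "\<not> finite (Field \<kappa>)" and co: "Card_order \<kappa>"
    using \<kappa> by (auto simp: cinfinite_def)
  define F where "F n = ((\<lambda>G. (\<lambda>(x, X). insert x X) ` (A \<times> G)) ^^ n) {{}}" for n :: nat
  have F_le: "|F n| \<le>o \<kappa>" for n
  proof (induction n)
    case 0
    show ?case
      using finite_ordLess_Cinfinite[OF \<kappa>, of "F 0"] by (simp add: F_def ordLess_imp_ordLeq)
  next
    case (Suc n)
    have "|A \<times> F n| \<le>o \<kappa>"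
      using Suc by (intro card_of_Sigma_ordLeq_infinite_Field[OF inf co A] ballI)
    moreover have "F (Suc n) = (\<lambda>(x, X). insert x X) ` (A \<times> F n)"
      by (simp add: F_def)
    ultimately show ?case
      by (metis card_of_image ordLeq_transitive)
  qed
  have "X \<in> (\<Union>n. F n)" if "finite X" "X \<subseteq> A" for X
    using that
  proof (induction X)
    case empty
    have "{} \<in> F 0" by (simp add: F_def)
    then show ?case by blast
  next
    case (insert x X)
    then obtain n where "X \<in> F n" by auto
    then have "insert x X \<in> F (Suc n)"
      using insert.prems unfolding F_def by (auto intro: rev_image_eqI[of "(x, X)"])
    then show ?case by blast
  qed
  then have "Fpow A \<subseteq> (\<Union>n. F n)"
    by (auto simp: Fpow_def)
  moreover have "|\<Union>n. F n| \<le>o \<kappa>"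
  proof (rule card_of_UNION_ordLeq_infinite_Field[OF inf co])
    show "|UNIV :: nat set| \<le>o \<kappa>"
      using \<kappa> by (meson card_of_nat natLeq_ordLeq_cinfinite ordIso_ordLeq_trans)
  qed (use F_le in blast)
  ultimately show ?thesis
    by (meson card_of_mono1 ordLeq_transitive)
qed

lemma card_of_Fpow_less:
  assumes \<kappa>: "Cinfinite \<kappa>" and A: "|A| <o \<kappa>"
  shows "|Fpow A| <o \<kappa>"
proof (cases "finite A")
  case True
  then have "finite (Fpow A)" by (simp add: Fpow_def)
  then show ?thesis using \<kappa> finite_ordLess_Cinfinite by blast
next
  case False
  then have "Cinfinite |A|"
    by (simp add: cinfinite_def Field_card_of card_of_card_order_on)
  then have "|Fpow A| \<le>o |A|"
    by (rule card_of_Fpow_le) (simp add: ordLeq_refl card_of_Card_order)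
  then show ?thesis using A ordLeq_ordLess_trans by blast
qed

lemma finite_chain_has_greatest:
  assumes "finite q" "q \<noteq> {}" "\<And>x y. x \<in> q \<Longrightarrow> y \<in> q \<Longrightarrow> (x, y) \<in> r \<or> (y, x) \<in> r"
    and "trans r"
  shows "\<exists>m\<in>q. \<forall>x\<in>q. (x, m) \<in> r"
  using assms(1-3)
proof (induction rule: finite_ne_induct)
  case (singleton x)
  then show ?case by blast
next
  case (insert x F)
  then obtain m where m: "m \<in> F" "\<forall>y\<in>F. (y, m) \<in> r" by blast
  have "(x, m) \<in> r \<or> (m, x) \<in> r" "(x, x) \<in> r" using insert.prems m(1) by blast+
  then show ?case using m transD[OF \<open>trans r\<close>] by blast
qed


section \<open>Injective renaming of variables\<close>

text \<open>
  Formulas with parameters carry their parameters in an assignment. To put two of them under one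
  assignment, or to move the free variable 0 elsewhere, variables are renamed; renaming bound
  variables along with free ones makes capture impossible as long as the renaming is injective.
\<close>

fun rename_tm :: "(nat \<Rightarrow> nat) \<Rightarrow> 'f tm \<Rightarrow> 'f tm" where
  "rename_tm \<pi> (Var n) = Var (\<pi> n)"
| "rename_tm \<pi> (Fn f ts) = Fn f (map (rename_tm \<pi>) ts)"

fun rename :: "(nat \<Rightarrow> nat) \<Rightarrow> ('f, 'r) fm \<Rightarrow> ('f, 'r) fm" where
  "rename \<pi> (Eq s t) = Eq (rename_tm \<pi> s) (rename_tm \<pi> t)"
| "rename \<pi> (Rel R ts) = Rel R (map (rename_tm \<pi>) ts)"
| "rename \<pi> (Neg \<phi>) = Neg (rename \<pi> \<phi>)"
| "rename \<pi> (Conj \<phi> \<psi>) = Conj (rename \<pi> \<phi>) (rename \<pi> \<psi>)"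
| "rename \<pi> (Ex n \<phi>) = Ex (\<pi> n) (rename \<pi> \<phi>)"

lemma wf_rename_tm: "wf_tm Lg (rename_tm \<pi> t) \<longleftrightarrow> wf_tm Lg t"
  by (induction t) auto

lemma wf_rename: "wf_fm Lg (rename \<pi> \<phi>) \<longleftrightarrow> wf_fm Lg \<phi>"
  by (induction \<phi>) (auto simp: wf_rename_tm)

lemma fv_rename_tm: "fv_tm (rename_tm \<pi> t) = \<pi> ` fv_tm t"
  by (induction t) auto

lemma fv_rename: "inj \<pi> \<Longrightarrow> fv (rename \<pi> \<phi>) = \<pi> ` fv \<phi>"
  by (induction \<phi>) (auto simp: fv_rename_tm image_Un image_UN inj_eq)

lemma eval_rename_tm: "eval M e (rename_tm \<pi> t) = eval M (e \<circ> \<pi>) t"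
  by (induction t) (auto cong: map_cong)

lemma sat_rename: "inj \<pi> \<Longrightarrow> sat M e (rename \<pi> \<phi>) \<longleftrightarrow> sat M (e \<circ> \<pi>) \<phi>"
proof (induction \<phi> arbitrary: e)
  case (Ex n \<phi>)
  have "e(\<pi> n := x) \<circ> \<pi> = (e \<circ> \<pi>)(n := x)" for x
    using Ex.prems by (auto simp: fun_eq_iff inj_eq)
  then show ?case using Ex.IH[OF Ex.prems] by (metis rename.simps(5) sat.simps(5))
qed (auto simp: eval_rename_tm comp_def[of "eval M _"])

lemma eval_cong: "(\<And>k. k \<in> fv_tm t \<Longrightarrow> e k = e' k) \<Longrightarrow> eval M e t = eval M e' t"
proof (induction t)
  case (Fn f ts)
  then have "map (eval M e) ts = map (eval M e') ts" by auto
  then show ?case by (metis eval.simps(2))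
qed simp

lemma sat_cong: "(\<And>k. k \<in> fv \<phi> \<Longrightarrow> e k = e' k) \<Longrightarrow> sat M e \<phi> \<longleftrightarrow> sat M e' \<phi>"
proof (induction \<phi> arbitrary: e e')
  case (Eq s t)
  then have "eval M e s = eval M e' s" "eval M e t = eval M e' t"
    by (auto intro!: eval_cong)
  then show ?case by simp
next
  case (Rel R ts)
  then have "map (eval M e) ts = map (eval M e') ts"
    by (auto intro!: eval_cong)
  then show ?case by (metis sat.simps(2))
next
  case (Ex n \<phi>)
  then have "sat M (e(n := x)) \<phi> \<longleftrightarrow> sat M (e'(n := x)) \<phi>" for x
    by (intro Ex.IH) auto
  then show ?case by simp
next
  case (Neg \<phi>)
  have "sat M e \<phi> \<longleftrightarrow> sat M e' \<phi>"
    by (rule Neg.IH) (simp add: Neg.prems)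
  then show ?case by simp
next
  case (Conj \<phi> \<psi>)
  have "sat M e \<phi> \<longleftrightarrow> sat M e' \<phi>" "sat M e \<psi> \<longleftrightarrow> sat M e' \<psi>"
    by (rule Conj.IH; simp add: Conj.prems)+
  then show ?case by simp
qed


section \<open>Realizing small types\<close>

text \<open>
  The variables below n are the unknowns of a type, the others hold its parameters.
\<close>

definition over :: "nat \<Rightarrow> (nat \<Rightarrow> 'a) \<Rightarrow> (nat \<Rightarrow> 'a) \<Rightarrow> nat \<Rightarrow> 'a" where
  "over n g e = (\<lambda>k. if k < n then g k else e k)"

definition is_type ::
    "('f, 'r) lang \<Rightarrow> ('f, 'r, 'a) struct \<Rightarrow> nat \<Rightarrow> (('f, 'r) fm \<times> (nat \<Rightarrow> 'a)) set \<Rightarrow> bool" where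
  "is_type Lg M n p \<longleftrightarrow> (\<forall>\<phi> e. (\<phi>, e) \<in> p \<longrightarrow> wf_fm Lg \<phi> \<and> e ` (fv \<phi> - {..<n}) \<subseteq> univ M)"

definition realized ::
    "('f, 'r, 'a) struct \<Rightarrow> nat \<Rightarrow> (('f, 'r) fm \<times> (nat \<Rightarrow> 'a)) set \<Rightarrow> bool" where
  "realized M n p \<longleftrightarrow> (\<exists>g. g ` {..<n} \<subseteq> univ M \<and> (\<forall>\<phi> e. (\<phi>, e) \<in> p \<longrightarrow> sat M (over n g e) \<phi>))"

text \<open>
  Bounding the number of members of p, instead of the number of its parameters, makes this
  property pass to ultrapowers without counting formulas.
\<close>

definition realizes_types ::
    "('f, 'r) lang \<Rightarrow> ('f, 'r, 'a) struct \<Rightarrow> 'k rel \<Rightarrow> nat \<Rightarrow> bool" where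
  "realizes_types Lg M \<kappa> n \<longleftrightarrow>
     (\<forall>p. |p| \<le>o \<kappa> \<and> is_type Lg M n p \<and> (\<forall>q. finite q \<and> q \<subseteq> p \<longrightarrow> realized M n q) \<longrightarrow> realized M n p)"

lemma is_type_insert:
  "is_type Lg M n (insert (\<phi>, e) p) \<longleftrightarrow>
     wf_fm Lg \<phi> \<and> e ` (fv \<phi> - {..<n}) \<subseteq> univ M \<and> is_type Lg M n p"
  unfolding is_type_def by blast

lemma is_type_empty: "is_type Lg M n {}"
  by (simp add: is_type_def)

lemma is_type_subset: "is_type Lg M n p \<Longrightarrow> q \<subseteq> p \<Longrightarrow> is_type Lg M n q"
  unfolding is_type_def by blast

lemma realizes_typesD:
  assumes "realizes_types Lg M \<kappa> n" "|p| \<le>o \<kappa>" "is_type Lg M n p"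
    and "\<And>q. finite q \<Longrightarrow> q \<subseteq> p \<Longrightarrow> realized M n q"
  shows "realized M n p"
  using assms unfolding realizes_types_def by blast

lemma realizedI:
  assumes "g ` {..<n} \<subseteq> univ M" "\<And>\<phi> e. (\<phi>, e) \<in> p \<Longrightarrow> sat M (over n g e) \<phi>"
  shows "realized M n p"
  unfolding realized_def using assms by (intro exI[of _ g] conjI allI impI)

lemma realizedE:
  assumes "realized M n p"
  obtains g where "g ` {..<n} \<subseteq> univ M" "\<forall>\<phi> e. (\<phi>, e) \<in> p \<longrightarrow> sat M (over n g e) \<phi>"
  using assms unfolding realized_def by (elim exE conjE) (rule that)

lemma realized_1:
  fixes M :: "('f, 'r, 'a) struct"
  shows "realized M 1 p \<longleftrightarrow> (\<exists>x\<in>univ M. \<forall>\<phi> e. (\<phi>, e) \<in> p \<longrightarrow> sat M (e(0 := x)) \<phi>)"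
proof -
  have over: "over 1 g e = e(0 := g 0)" for g e :: "nat \<Rightarrow> 'a"
    by (auto simp: over_def)
  show ?thesis
  proof
    assume "realized M 1 p"
    then obtain g where g: "g ` {..<1} \<subseteq> univ M" "\<forall>\<phi> e. (\<phi>, e) \<in> p \<longrightarrow> sat M (over 1 g e) \<phi>"
      by (rule realizedE)
    show "\<exists>x\<in>univ M. \<forall>\<phi> e. (\<phi>, e) \<in> p \<longrightarrow> sat M (e(0 := x)) \<phi>"
    proof (intro bexI allI impI)
      show "g 0 \<in> univ M" using g(1) by auto
    qed (rule g(2)[unfolded over, rule_format])
  next
    assume "\<exists>x\<in>univ M. \<forall>\<phi> e. (\<phi>, e) \<in> p \<longrightarrow> sat M (e(0 := x)) \<phi>"
    then obtain x where x: "x \<in> univ M" "\<And>\<phi> e. (\<phi>, e) \<in> p \<Longrightarrow> sat M (e(0 := x)) \<phi>" by blast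
    show "realized M 1 p"
      by (rule realizedI[of "\<lambda>_. x"]) (use x in \<open>simp_all add: over del: One_nat_def\<close>, blast)
  qed
qed

text \<open>
  A formula has finitely many free variables, so a type with at most \<kappa> members
  has at most \<kappa> parameters.
\<close>

lemma saturated_imp_realizes_types:
  fixes M :: "('f, 'r, 'a) struct"
  assumes \<kappa>: "Cinfinite \<kappa>" and sat: "saturated Lg M (cardSuc \<kappa>)"
  shows "realizes_types Lg M \<kappa> 1"
  unfolding realizes_types_def
proof (intro allI impI, elim conjE)
  fix p :: "(('f, 'r) fm \<times> (nat \<Rightarrow> 'a)) set"
  assume p: "|p| \<le>o \<kappa>" "is_type Lg M 1 p"
    and fin: "\<forall>q. finite q \<and> q \<subseteq> p \<longrightarrow> realized M 1 q"
  define A where "A = (\<Union>(\<phi>, e)\<in>p. e ` (fv \<phi> - {0}))"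
  have finite_fv_tm: "finite (fv_tm t)" for t :: "'f tm"
    by (induction t) auto
  have finite_fv: "finite (fv \<phi>)" for \<phi> :: "('f, 'r) fm"
    by (induction \<phi>) (auto simp: finite_fv_tm)
  have co: "Card_order \<kappa>" and inf: "\<not> finite (Field \<kappa>)"
    using \<kappa> by (auto simp: cinfinite_def)
  have "|A| \<le>o \<kappa>"
    unfolding A_def
    by (rule card_of_UNION_ordLeq_infinite_Field[OF inf co p(1)])
      (auto intro!: ordLess_imp_ordLeq finite_ordLess_Cinfinite[OF \<kappa>] simp: finite_fv)
  then have "|A| <o cardSuc \<kappa>"
    by (simp add: cardSuc_ordLeq_ordLess co card_of_Card_order)
  moreover have "A \<subseteq> univ M"
    using p(2) unfolding A_def is_type_def lessThan_Suc One_nat_def lessThan_0 by blast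
  moreover have "\<forall>(\<phi>, e)\<in>p. wf_fm Lg \<phi> \<and> e ` (fv \<phi> - {0}) \<subseteq> A"
    using p(2) unfolding A_def is_type_def by blast
  moreover have "\<forall>q. finite q \<and> q \<subseteq> p \<longrightarrow> (\<exists>x\<in>univ M. \<forall>(\<phi>, e)\<in>q. sat M (e(0 := x)) \<phi>)"
    using fin unfolding realized_1 by fast
  ultimately have "\<exists>x\<in>univ M. \<forall>(\<phi>, e)\<in>p. sat M (e(0 := x)) \<phi>"
    using sat unfolding saturated_def by blast
  then show "realized M 1 p"
    unfolding realized_1 by fast
qed

lemma realizes_type_at_variable:
  fixes M :: "('f, 'r, 'a) struct"
  assumes real: "realizes_types Lg M \<kappa> 1" and p: "|p| \<le>o \<kappa>"
    and wf: "\<And>\<phi> e. (\<phi>, e) \<in> p \<Longrightarrow> wf_fm Lg \<phi> \<and> e ` (fv \<phi> - {v}) \<subseteq> univ M"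
    and fin: "\<And>q. finite q \<Longrightarrow> q \<subseteq> p \<Longrightarrow> \<exists>x\<in>univ M. \<forall>\<phi> e. (\<phi>, e) \<in> q \<longrightarrow> sat M (e(v := x)) \<phi>"
  shows "\<exists>x\<in>univ M. \<forall>\<phi> e. (\<phi>, e) \<in> p \<longrightarrow> sat M (e(v := x)) \<phi>"
proof -
  define \<pi> where "\<pi> = (\<lambda>k. if k = v then 0 else if k = 0 then v else k)"
  have inj: "inj \<pi>" by (auto simp: \<pi>_def inj_def)
  define h where "h = (\<lambda>(\<phi> :: ('f, 'r) fm, e :: nat \<Rightarrow> 'a). (rename \<pi> \<phi>, e \<circ> \<pi>))"
  have upd: "(e \<circ> \<pi>)(0 := x) \<circ> \<pi> = e(v := x)" for e :: "nat \<Rightarrow> 'a" and x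
    by (auto simp: \<pi>_def fun_eq_iff)
  have real_h: "realized M 1 (h ` q) \<longleftrightarrow> (\<exists>x\<in>univ M. \<forall>\<phi> e. (\<phi>, e) \<in> q \<longrightarrow> sat M (e(v := x)) \<phi>)" for q
  proof -
    have mem: "(\<psi>, e') \<in> h ` q \<longleftrightarrow> (\<exists>\<phi> e. (\<phi>, e) \<in> q \<and> \<psi> = rename \<pi> \<phi> \<and> e' = e \<circ> \<pi>)" for \<psi> e'
      unfolding h_def by (auto intro: image_eqI[rotated])
    have "(\<forall>\<psi> e'. (\<psi>, e') \<in> h ` q \<longrightarrow> sat M (e'(0 := x)) \<psi>) \<longleftrightarrow>
        (\<forall>\<phi> e. (\<phi>, e) \<in> q \<longrightarrow> sat M ((e \<circ> \<pi>)(0 := x)) (rename \<pi> \<phi>))" for x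
      unfolding mem by (simp only: imp_ex simp_thms imp_conjL) blast
    then show ?thesis
      unfolding realized_1 by (simp only: sat_rename[OF inj] upd)
  qed
  have "wf_fm Lg \<psi> \<and> e' ` (fv \<psi> - {..<1}) \<subseteq> univ M" if \<psi>: "(\<psi>, e') \<in> h ` p" for \<psi> e'
  proof -
    obtain \<phi> e where *: "(\<phi>, e) \<in> p" "\<psi> = rename \<pi> \<phi>" "e' = e \<circ> \<pi>"
      using \<psi> by (auto simp: h_def)
    have "e' ` (fv \<psi> - {..<1}) \<subseteq> e ` (fv \<phi> - {v})"
      unfolding * fv_rename[OF inj] by (auto simp: \<pi>_def)
    then show "wf_fm Lg \<psi> \<and> e' ` (fv \<psi> - {..<1}) \<subseteq> univ M"
      using wf[OF *(1)] by (auto simp: * wf_rename)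
  qed
  then have "is_type Lg M 1 (h ` p)"
    unfolding is_type_def by blast
  moreover have "|h ` p| \<le>o \<kappa>"
    using p card_of_image ordLeq_transitive by blast
  moreover have "realized M 1 q'" if q': "finite q'" "q' \<subseteq> h ` p" for q'
  proof -
    obtain q where "q \<subseteq> p" "finite q" "q' = h ` q"
      using q' finite_subset_image by metis
    then show ?thesis using fin by (simp add: real_h del: One_nat_def)
  qed
  ultimately have "realized M 1 (h ` p)"
    using real unfolding realizes_types_def by blast
  then show ?thesis unfolding real_h .
qed

text \<open>
  The parameters of the two formulas are moved to disjoint sets of variables: beyond the m
  unknowns, those of the first go to even places and those of the second to odd ones.
\<close>

lemma conj_of_two:
  fixes M :: "('f, 'r, 'a) struct"
  assumes "is_type Lg M m {(\<phi>1, e1), (\<phi>2, e2)}"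
  obtains \<chi> \<epsilon> where "is_type Lg M m {(\<chi>, \<epsilon>)}"
    and "\<And>g. sat M (over m g \<epsilon>) \<chi> \<longleftrightarrow> sat M (over m g e1) \<phi>1 \<and> sat M (over m g e2) \<phi>2"
proof
  define \<pi>1 \<pi>2 where "\<pi>1 = (\<lambda>k. if k < m then k else m + 2 * (k - m))"
    and "\<pi>2 = (\<lambda>k. if k < m then k else m + 2 * (k - m) + 1)"
  define \<epsilon> where
    "\<epsilon> = (\<lambda>k. if even (k - m) then e1 (m + (k - m) div 2) else e2 (m + (k - m) div 2))"
  have inj: "inj \<pi>1" "inj \<pi>2"
    by (auto simp: \<pi>1_def \<pi>2_def inj_def split: if_splits)
  have over: "over m g \<epsilon> \<circ> \<pi>1 = over m g e1" "over m g \<epsilon> \<circ> \<pi>2 = over m g e2" for g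
    by (auto simp: over_def \<pi>1_def \<pi>2_def \<epsilon>_def fun_eq_iff)
  have params: "\<epsilon> ` (\<pi> ` V - {..<m}) \<subseteq> univ M"
    if \<pi>: "\<And>k. \<not> k < m \<Longrightarrow> \<epsilon> (\<pi> k) = e k" "\<And>k. k < m \<Longrightarrow> \<pi> k < m"
      and e: "e ` (V - {..<m}) \<subseteq> univ M" for \<pi> V and e :: "nat \<Rightarrow> 'a"
  proof (rule image_subsetI)
    fix j assume "j \<in> \<pi> ` V - {..<m}"
    then obtain k where "k \<in> V" "j = \<pi> k" "\<not> k < m" using \<pi>(2) by auto
    then show "\<epsilon> j \<in> univ M" using \<pi>(1) e by auto
  qed
  have e: "e1 ` (fv \<phi>1 - {..<m}) \<subseteq> univ M" "e2 ` (fv \<phi>2 - {..<m}) \<subseteq> univ M"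
    using assms unfolding is_type_insert by blast+
  have "\<epsilon> ` (\<pi>1 ` fv \<phi>1 - {..<m}) \<subseteq> univ M"
    by (rule params[OF _ _ e(1)]; simp add: \<epsilon>_def \<pi>1_def)
  moreover have "\<epsilon> ` (\<pi>2 ` fv \<phi>2 - {..<m}) \<subseteq> univ M"
    by (rule params[OF _ _ e(2)]; simp add: \<epsilon>_def \<pi>2_def)
  ultimately show "is_type Lg M m {(Conj (rename \<pi>1 \<phi>1) (rename \<pi>2 \<phi>2), \<epsilon>)}"
    using assms
    by (simp add: is_type_insert is_type_empty wf_rename fv_rename[OF inj(1)] fv_rename[OF inj(2)] image_Un Un_Diff)
  show "sat M (over m g \<epsilon>) (Conj (rename \<pi>1 \<phi>1) (rename \<pi>2 \<phi>2)) \<longleftrightarrow>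
      sat M (over m g e1) \<phi>1 \<and> sat M (over m g e2) \<phi>2" for g
    by (simp add: sat_rename[OF inj(1)] sat_rename[OF inj(2)] over)
qed

lemma conj_of_finite:
  assumes "finite q" "is_type Lg M (Suc n) q"
  shows "\<exists>\<chi> \<epsilon>. is_type Lg M (Suc n) {(\<chi>, \<epsilon>)} \<and>
    (\<forall>g. sat M (over (Suc n) g \<epsilon>) \<chi> \<longleftrightarrow> (\<forall>\<phi> e. (\<phi>, e) \<in> q \<longrightarrow> sat M (over (Suc n) g e) \<phi>))"
  using assms
proof (induction q)
  case empty
  \<comment> \<open>A true formula has to mention a variable; 0 is an unknown because there are Suc n of them.\<close>
  show ?case
    by (intro exI[of _ "Eq (Var 0) (Var 0)"] exI) (auto simp: is_type_def)
next
  case (insert x q)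
  obtain \<phi> e where x: "x = (\<phi>, e)" by (cases x)
  have "is_type Lg M (Suc n) q"
    using insert.prems unfolding x is_type_insert by blast
  from insert.IH[OF this] obtain \<chi> \<epsilon> where 1: "is_type Lg M (Suc n) {(\<chi>, \<epsilon>)}"
    "\<forall>g. sat M (over (Suc n) g \<epsilon>) \<chi> \<longleftrightarrow> (\<forall>\<phi> e. (\<phi>, e) \<in> q \<longrightarrow> sat M (over (Suc n) g e) \<phi>)"
    by (elim exE conjE)
  have "is_type Lg M (Suc n) {(\<phi>, e), (\<chi>, \<epsilon>)}"
    using 1(1) insert.prems by (simp add: is_type_insert is_type_empty x)
  then obtain \<chi>' \<epsilon>' where "is_type Lg M (Suc n) {(\<chi>', \<epsilon>')}"
    "\<And>g. sat M (over (Suc n) g \<epsilon>') \<chi>' \<longleftrightarrow> sat M (over (Suc n) g e) \<phi> \<and> sat M (over (Suc n) g \<epsilon>) \<chi>"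
    using conj_of_two[of Lg M "Suc n" \<phi> e \<chi> \<epsilon>] by metis
  then show ?case
    by (intro exI[of _ \<chi>'] exI[of _ \<epsilon>']) (auto simp: 1(2) x)
qed

text \<open>
  Saturation speaks of single elements, but interpreted orders consist of tuples. The unknowns are
  found one after the other: the formulas that bind the last unknown of the finite conjunctions of
  the type form a type in the remaining ones. Once this is realized, what is left is a finitely
  satisfiable type in the last unknown. The number of finite conjunctions is again at most \<kappa>.
\<close>

lemma realizes_types_tuples:
  fixes M :: "('f, 'r, 'a) struct"
  assumes \<kappa>: "Cinfinite \<kappa>" and real: "realizes_types Lg M \<kappa> 1"
  shows "realizes_types Lg M \<kappa> n"
proof (induction n)
  case 0
  show ?case
    unfolding realizes_types_def
  proof (intro allI impI, elim conjE)
    fix p :: "(('f, 'r) fm \<times> (nat \<Rightarrow> 'a)) set"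
    assume fin: "\<forall>q. finite q \<and> q \<subseteq> p \<longrightarrow> realized M 0 q"
    show "realized M 0 p"
    proof (rule realizedI)
      fix \<phi> e assume "(\<phi>, e) \<in> p"
      then have "realized M 0 {(\<phi>, e)}" using fin by simp
      then show "sat M (over 0 undefined e) \<phi>" by (auto simp: realized_def over_def)
    qed simp
  qed
next
  case (Suc n)
  show ?case
    unfolding realizes_types_def
  proof (intro allI impI, elim conjE)
    fix p :: "(('f, 'r) fm \<times> (nat \<Rightarrow> 'a)) set"
    assume p: "|p| \<le>o \<kappa>" "is_type Lg M (Suc n) p"
      and fin: "\<forall>q. finite q \<and> q \<subseteq> p \<longrightarrow> realized M (Suc n) q"
    have over_Suc: "(over n g e)(n := x) = over (Suc n) (g(n := x)) e"
      for g e :: "nat \<Rightarrow> 'a" and x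
      by (auto simp: over_def fun_eq_iff)
    have "\<forall>q\<in>Fpow p. \<exists>\<chi> \<epsilon>. is_type Lg M (Suc n) {(\<chi>, \<epsilon>)} \<and>
      (\<forall>g. sat M (over (Suc n) g \<epsilon>) \<chi> \<longleftrightarrow> (\<forall>\<phi> e. (\<phi>, e) \<in> q \<longrightarrow> sat M (over (Suc n) g e) \<phi>))"
      using is_type_subset[OF p(2)] by (intro ballI conj_of_finite) (auto simp: Fpow_def)
    then obtain \<chi> \<epsilon> where type: "\<And>q. q \<in> Fpow p \<Longrightarrow> is_type Lg M (Suc n) {(\<chi> q, \<epsilon> q)}"
      and sat_\<chi>: "\<And>q g. q \<in> Fpow p \<Longrightarrow>
        sat M (over (Suc n) g (\<epsilon> q)) (\<chi> q) \<longleftrightarrow> (\<forall>\<phi> e. (\<phi>, e) \<in> q \<longrightarrow> sat M (over (Suc n) g e) \<phi>)"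
      by metis
    define p' where "p' = (\<lambda>q. (Ex n (\<chi> q), \<epsilon> q)) ` Fpow p"
    have sat_Ex: "sat M (over n g (\<epsilon> q)) (Ex n (\<chi> q)) \<longleftrightarrow>
        (\<exists>x\<in>univ M. \<forall>\<phi> e. (\<phi>, e) \<in> q \<longrightarrow> sat M (over (Suc n) (g(n := x)) e) \<phi>)"
      if "q \<in> Fpow p" for q g
      by (simp only: sat.simps over_Suc sat_\<chi>[OF that])
    have "realized M n p'"
    proof (rule realizes_typesD[OF Suc.IH])
      show "|p'| \<le>o \<kappa>"
        unfolding p'_def using card_of_Fpow_le[OF \<kappa> p(1)] card_of_image ordLeq_transitive by blast
      have "fv (Ex n \<psi>) - {..<n} = fv \<psi> - {..<Suc n}" for \<psi> :: "('f, 'r) fm"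
        by auto
      then have "wf_fm Lg (Ex n (\<chi> q)) \<and> \<epsilon> q ` (fv (Ex n (\<chi> q)) - {..<n}) \<subseteq> univ M"
        if "q \<in> Fpow p" for q
        using type[OF that] by (simp only: is_type_insert wf_fm.simps simp_thms)
      then show "is_type Lg M n p'"
        unfolding is_type_def p'_def by blast
      fix q' assume q': "finite q'" "q' \<subseteq> p'"
      obtain Q where Q: "Q \<subseteq> Fpow p" "finite Q" "q' = (\<lambda>q. (Ex n (\<chi> q), \<epsilon> q)) ` Q"
        using finite_subset_image[OF q'[unfolded p'_def]] by blast
      have "finite (\<Union>Q)" "\<Union>Q \<subseteq> p"
        using Q by (auto simp: Fpow_def)
      then have "realized M (Suc n) (\<Union>Q)"
        using fin by blast
      then obtain g where g: "g ` {..<Suc n} \<subseteq> univ M"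
        "\<forall>\<phi> e. (\<phi>, e) \<in> \<Union>Q \<longrightarrow> sat M (over (Suc n) g e) \<phi>"
        by (rule realizedE)
      show "realized M n q'"
      proof (rule realizedI[of g])
        show "g ` {..<n} \<subseteq> univ M" using g(1) by auto
        have "sat M (over n g (\<epsilon> q)) (Ex n (\<chi> q))" if "q \<in> Q" for q
        proof (subst sat_Ex)
          show "q \<in> Fpow p" using that Q(1) by blast
          have "g n \<in> univ M" using g(1) by auto
          moreover have "\<forall>\<phi> e. (\<phi>, e) \<in> q \<longrightarrow> sat M (over (Suc n) (g(n := g n)) e) \<phi>"
            using g(2) that by auto
          ultimately show "\<exists>x\<in>univ M. \<forall>\<phi> e. (\<phi>, e) \<in> q \<longrightarrow> sat M (over (Suc n) (g(n := x)) e) \<phi>"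
            by blast
        qed
        then show "sat M (over n g e) \<phi>" if "(\<phi>, e) \<in> q'" for \<phi> e
          using that unfolding Q(3) by blast
      qed
    qed
    then obtain g where g: "g ` {..<n} \<subseteq> univ M" "\<forall>\<phi> e. (\<phi>, e) \<in> p' \<longrightarrow> sat M (over n g e) \<phi>"
      by (rule realizedE)
    define h where "h = (\<lambda>(\<phi> :: ('f, 'r) fm, e). (\<phi>, over n g e))"
    have "\<exists>x\<in>univ M. \<forall>\<phi> e. (\<phi>, e) \<in> h ` p \<longrightarrow> sat M (e(n := x)) \<phi>"
    proof (rule realizes_type_at_variable[OF real])
      show "|h ` p| \<le>o \<kappa>"
        using p(1) card_of_image ordLeq_transitive by blast
      show "wf_fm Lg \<phi> \<and> e' ` (fv \<phi> - {n}) \<subseteq> univ M" if \<phi>: "(\<phi>, e') \<in> h ` p" for \<phi> e'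
      proof -
        obtain e where e: "(\<phi>, e) \<in> p" "e' = over n g e"
          using \<phi> by (auto simp: h_def)
        have "e' ` (fv \<phi> - {n}) \<subseteq> g ` {..<n} \<union> e ` (fv \<phi> - {..<Suc n})"
          by (auto simp: e over_def)
        then show ?thesis
          using p(2) e(1) g(1) unfolding is_type_def by blast
      qed
      show "\<exists>x\<in>univ M. \<forall>\<phi> e. (\<phi>, e) \<in> q' \<longrightarrow> sat M (e(n := x)) \<phi>"
        if "finite q'" "q' \<subseteq> h ` p" for q'
      proof -
        obtain q where q: "q \<subseteq> p" "finite q" "q' = h ` q"
          using finite_subset_image[OF \<open>finite q'\<close> \<open>q' \<subseteq> h ` p\<close>] by blast
        then have q_Fpow: "q \<in> Fpow p" by (simp add: Fpow_def)
        then have "sat M (over n g (\<epsilon> q)) (Ex n (\<chi> q))"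
          using g(2) unfolding p'_def by blast
        then have "\<exists>x\<in>univ M. \<forall>\<phi> e. (\<phi>, e) \<in> q \<longrightarrow> sat M ((over n g e)(n := x)) \<phi>"
          unfolding over_Suc sat_Ex[OF q_Fpow] .
        then obtain x where x: "x \<in> univ M"
          "\<forall>\<phi> e. (\<phi>, e) \<in> q \<longrightarrow> sat M ((over n g e)(n := x)) \<phi>"
          by (elim bexE)
        have "sat M (e'(n := x)) \<phi>" if "(\<phi>, e') \<in> q'" for \<phi> e'
          using that x(2) by (auto simp: q(3) h_def)
        then show ?thesis
          using x(1) by blast
      qed
    qed
    then obtain x where x: "x \<in> univ M" "\<And>\<phi> e. (\<phi>, e) \<in> h ` p \<Longrightarrow> sat M (e(n := x)) \<phi>"
      by blast
    have "(\<phi>, over n g e) \<in> h ` p" if "(\<phi>, e) \<in> p" for \<phi> e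
      using that by (force simp: h_def)
    then show "realized M (Suc n) p"
      using x g(1) by (intro realizedI[of "g(n := x)"]) (auto simp: less_Suc_eq simp flip: over_Suc)
  qed
qed


section \<open>Ultrapowers\<close>

locale struct_ultrafilter =
  fixes I :: "'i set" and E :: "'i set set"
    and Lg :: "('f, 'r) lang" and M :: "('f, 'r, 'a) struct"
  assumes ultrafilter: "ultrafilter_on I E" and struct: "is_struct Lg M"
begin

text \<open>
  The ultrafilter as a filter in the sense of limits, so that statements about almost all
  coordinates can be combined with the rules for eventual truth.
\<close>

definition ufilter :: "'i filter" where
  "ufilter = Abs_filter (\<lambda>P. {t \<in> I. P t} \<in> E)"

abbreviation N :: "('f, 'r, ('i \<Rightarrow> 'a) set) struct" where
  "N \<equiv> ultrapower I E M"

abbreviation proj :: "'i \<Rightarrow> (nat \<Rightarrow> ('i \<Rightarrow> 'a) set) \<Rightarrow> nat \<Rightarrow> 'a" where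
  "proj t e \<equiv> (\<lambda>n. up_rep (e n) t)"

lemma eventually_ufilter: "eventually P ufilter \<longleftrightarrow> {t \<in> I. P t} \<in> E"
  unfolding ufilter_def
proof (rule eventually_Abs_filter, rule is_filter.intro)
  show "{t \<in> I. True} \<in> E"
    using ultrafilter by (simp add: ultrafilter_on_def)
next
  fix P Q assume *: "{t \<in> I. P t} \<in> E" "{t \<in> I. Q t} \<in> E"
  have "{t \<in> I. P t \<and> Q t} = {t \<in> I. P t} \<inter> {t \<in> I. Q t}" by blast
  then show "{t \<in> I. P t \<and> Q t} \<in> E"
    using * ultrafilter by (simp add: ultrafilter_on_def)
next
  fix P Q :: "'i \<Rightarrow> bool" assume *: "\<forall>t. P t \<longrightarrow> Q t" "{t \<in> I. P t} \<in> E"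
  then have "{t \<in> I. P t} \<subseteq> {t \<in> I. Q t}" "{t \<in> I. Q t} \<subseteq> I" by blast+
  then show "{t \<in> I. Q t} \<in> E"
    using *(2) ultrafilter unfolding ultrafilter_on_def by blast
qed

lemma eventually_index: "\<forall>\<^sub>F t in ufilter. t \<in> I"
  using ultrafilter by (simp add: eventually_ufilter ultrafilter_on_def)

lemma eventually_Not: "(\<forall>\<^sub>F t in ufilter. \<not> P t) \<longleftrightarrow> \<not> (\<forall>\<^sub>F t in ufilter. P t)"
proof -
  have "I - {t \<in> I. P t} = {t \<in> I. \<not> P t}" "{t \<in> I. P t} \<inter> {t \<in> I. \<not> P t} = {}"
    by blast+
  moreover have "{t \<in> I. P t} \<subseteq> I" by blast
  ultimately show ?thesis
    using ultrafilter unfolding eventually_ufilter ultrafilter_on_def by metis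
qed

lemma up_class_eq_Collect:
  "g \<in> I \<rightarrow>\<^sub>E univ M \<Longrightarrow>
     up_class I E M g = {h \<in> I \<rightarrow>\<^sub>E univ M. \<forall>\<^sub>F t in ufilter. g t = h t}"
  by (auto simp: up_class_def up_rel_def eventually_ufilter)

lemma up_class_eqI:
  assumes "g \<in> I \<rightarrow>\<^sub>E univ M" "h \<in> I \<rightarrow>\<^sub>E univ M" "\<forall>\<^sub>F t in ufilter. g t = h t"
  shows "up_class I E M g = up_class I E M h"
  unfolding up_class_eq_Collect[OF assms(1)] up_class_eq_Collect[OF assms(2)]
proof (intro Collect_cong conj_cong refl)
  fix k
  show "(\<forall>\<^sub>F t in ufilter. g t = k t) \<longleftrightarrow> (\<forall>\<^sub>F t in ufilter. h t = k t)"
    by (rule eventually_cong[OF assms(3)]) simp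
qed

lemma univ_ultrapower: "univ N = up_class I E M ` (I \<rightarrow>\<^sub>E univ M)"
  by (auto simp: ultrapower_def quotient_def up_class_def)

lemma up_rep:
  assumes "X \<in> univ N"
  shows "up_rep X \<in> I \<rightarrow>\<^sub>E univ M" and "up_class I E M (up_rep X) = X"
proof -
  obtain g where g: "g \<in> I \<rightarrow>\<^sub>E univ M" "X = up_class I E M g"
    using assms by (auto simp: univ_ultrapower)
  then have "g \<in> X" by (simp add: up_class_eq_Collect)
  then have "up_rep X \<in> X" unfolding up_rep_def by (rule someI[of "\<lambda>g. g \<in> X"])
  then have *: "up_rep X \<in> I \<rightarrow>\<^sub>E univ M" "\<forall>\<^sub>F t in ufilter. g t = up_rep X t"
    using g by (simp_all add: up_class_eq_Collect)
  then show "up_rep X \<in> I \<rightarrow>\<^sub>E univ M" by blast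
  show "up_class I E M (up_rep X) = X"
    using up_class_eqI[OF g(1) *] g(2) by metis
qed

lemma up_rep_in: "X \<in> univ N \<Longrightarrow> t \<in> I \<Longrightarrow> up_rep X t \<in> univ M"
  using up_rep(1) by blast

lemma up_rep_up_class:
  assumes "g \<in> I \<rightarrow>\<^sub>E univ M"
  shows "\<forall>\<^sub>F t in ufilter. up_rep (up_class I E M g) t = g t"
proof -
  have "up_class I E M g \<in> univ N"
    using assms by (simp add: univ_ultrapower)
  from up_rep(2)[OF this] have "up_rep (up_class I E M g) \<in> up_class I E M g"
    using up_rep(1)[OF \<open>up_class I E M g \<in> univ N\<close>] up_class_eq_Collect by fastforce
  then show ?thesis
    using assms by (simp add: up_class_eq_Collect eq_commute)
qed

lemma eq_iff_eventually:
  assumes "X \<in> univ N" "Y \<in> univ N"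
  shows "X = Y \<longleftrightarrow> (\<forall>\<^sub>F t in ufilter. up_rep X t = up_rep Y t)"
proof
  assume "\<forall>\<^sub>F t in ufilter. up_rep X t = up_rep Y t"
  then have "up_class I E M (up_rep X) = up_class I E M (up_rep Y)"
    by (rule up_class_eqI[OF up_rep(1)[OF assms(1)] up_rep(1)[OF assms(2)]])
  then show "X = Y" by (simp only: up_rep(2) assms)
qed simp

text \<open>
  The axiom of choice in each coordinate; this is the existential step in the theorem of Los.
\<close>

lemma eventually_choice:
  assumes "\<forall>\<^sub>F t in ufilter. \<exists>x\<in>univ M. P t x"
  shows "\<exists>X\<in>univ N. \<forall>\<^sub>F t in ufilter. P t (up_rep X t)"
proof -
  obtain d where d: "d \<in> univ M" using struct by (auto simp: is_struct_def)
  define g where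
    "g = (\<lambda>t\<in>I. if \<exists>x\<in>univ M. P t x then SOME x. x \<in> univ M \<and> P t x else d)"
  have some: "(SOME x. x \<in> univ M \<and> P t x) \<in> univ M \<and> P t (SOME x. x \<in> univ M \<and> P t x)"
    if "\<exists>x\<in>univ M. P t x" for t
    using that by (intro someI_ex[of "\<lambda>x. x \<in> univ M \<and> P t x"]) blast
  then have g: "g \<in> I \<rightarrow>\<^sub>E univ M"
    using d by (auto simp: g_def)
  have "\<forall>\<^sub>F t in ufilter. P t (up_rep (up_class I E M g) t)"
    using assms up_rep_up_class[OF g] eventually_index
    by eventually_elim (use some in \<open>simp add: g_def\<close>)
  moreover have "up_class I E M g \<in> univ N"
    using g by (simp add: univ_ultrapower)
  ultimately show ?thesis by blast
qed

lemma eval_ultrapower: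
  assumes "wf_tm Lg \<tau>" "e ` fv_tm \<tau> \<subseteq> univ N"
  shows "eval N e \<tau> \<in> univ N \<and> (\<forall>\<^sub>F t in ufilter. up_rep (eval N e \<tau>) t = eval M (proj t e) \<tau>)"
  using assms
proof (induction \<tau>)
  case (Fn f ts)
  have IH: "eval N e \<tau> \<in> univ N" "\<forall>\<^sub>F t in ufilter. up_rep (eval N e \<tau>) t = eval M (proj t e) \<tau>"
    if "\<tau> \<in> set ts" for \<tau>
    using Fn.IH[OF that] Fn.prems that by auto
  let ?Xs = "map (eval N e) ts"
  define g where "g = (\<lambda>t\<in>I. fun_int M f (map (\<lambda>X. up_rep X t) ?Xs))"
  have "(f, length ts) \<in> funs Lg" using Fn.prems by simp
  moreover have "set (map (\<lambda>X. up_rep X t) ?Xs) \<subseteq> univ M" if "t \<in> I" for t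
    using IH(1) up_rep_in[OF _ that] by auto
  ultimately have g: "g \<in> I \<rightarrow>\<^sub>E univ M"
    using struct unfolding is_struct_def g_def by fastforce
  have ev: "eval N e (Fn f ts) = up_class I E M g"
    by (simp add: ultrapower_def g_def)
  have "\<forall>\<^sub>F t in ufilter. \<forall>\<tau>\<in>set ts. up_rep (eval N e \<tau>) t = eval M (proj t e) \<tau>"
    using IH(2) by (intro eventually_ball_finite) auto
  with up_rep_up_class[OF g] eventually_index
  have "\<forall>\<^sub>F t in ufilter. up_rep (eval N e (Fn f ts)) t = eval M (proj t e) (Fn f ts)"
  proof eventually_elim
    case (elim t)
    have "map (\<lambda>X. up_rep X t) ?Xs = map (eval M (proj t e)) ts"
      using elim(3) by simp
    then have "g t = eval M (proj t e) (Fn f ts)"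
      using elim(2) unfolding g_def by (simp only: restrict_apply' eval.simps)
    then show ?case unfolding ev elim(1) .
  qed
  moreover have "eval N e (Fn f ts) \<in> univ N"
    using g unfolding ev univ_ultrapower by (rule imageI)
  ultimately show ?case by blast
qed simp

lemma los:
  assumes "wf_fm Lg \<phi>" "e ` fv \<phi> \<subseteq> univ N"
  shows "sat N e \<phi> \<longleftrightarrow> (\<forall>\<^sub>F t in ufilter. sat M (proj t e) \<phi>)"
  using assms
proof (induction \<phi> arbitrary: e)
  case (Eq \<sigma> \<tau>)
  then have \<sigma>: "eval N e \<sigma> \<in> univ N" "\<forall>\<^sub>F t in ufilter. up_rep (eval N e \<sigma>) t = eval M (proj t e) \<sigma>"
    and \<tau>: "eval N e \<tau> \<in> univ N" "\<forall>\<^sub>F t in ufilter. up_rep (eval N e \<tau>) t = eval M (proj t e) \<tau>"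
    using eval_ultrapower[of \<sigma> e] eval_ultrapower[of \<tau> e] by auto
  have "(\<forall>\<^sub>F t in ufilter. up_rep (eval N e \<sigma>) t = up_rep (eval N e \<tau>) t) \<longleftrightarrow>
      (\<forall>\<^sub>F t in ufilter. eval M (proj t e) \<sigma> = eval M (proj t e) \<tau>)"
    by (rule eventually_cong[OF eventually_conj[OF \<sigma>(2) \<tau>(2)]]) simp
  then show ?case by (simp add: eq_iff_eventually[OF \<sigma>(1) \<tau>(1)])
next
  case (Rel R ts)
  have "\<forall>\<^sub>F t in ufilter. \<forall>\<tau>\<in>set ts. up_rep (eval N e \<tau>) t = eval M (proj t e) \<tau>"
    using eval_ultrapower[of _ e] Rel.prems by (intro eventually_ball_finite) fastforce+
  then have "\<forall>\<^sub>F t in ufilter.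
      map (\<lambda>X. up_rep X t) (map (eval N e) ts) = map (eval M (proj t e)) ts"
    by (rule eventually_mono) simp
  then have "(\<forall>\<^sub>F t in ufilter. rel_int M R (map (\<lambda>X. up_rep X t) (map (eval N e) ts))) \<longleftrightarrow>
      (\<forall>\<^sub>F t in ufilter. rel_int M R (map (eval M (proj t e)) ts))"
    by (rule eventually_cong) (simp only:)
  then show ?case by (simp add: ultrapower_def eventually_ufilter)
next
  case (Neg \<phi>)
  then show ?case by (simp add: eventually_Not)
next
  case (Conj \<phi> \<psi>)
  then have "e ` fv \<phi> \<subseteq> univ N" "e ` fv \<psi> \<subseteq> univ N" by auto
  with Conj show ?case by (simp add: eventually_conj_iff)
next
  case (Ex n \<phi>)
  have upd: "proj t (e(n := X)) = (proj t e)(n := up_rep X t)" for t X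
    by auto
  have "sat N (e(n := X)) \<phi> \<longleftrightarrow> (\<forall>\<^sub>F t in ufilter. sat M ((proj t e)(n := up_rep X t)) \<phi>)"
    if "X \<in> univ N" for X
  proof -
    have "(e(n := X)) ` fv \<phi> \<subseteq> univ N" using Ex.prems(2) that by auto
    then show ?thesis using Ex.IH[of "e(n := X)"] Ex.prems(1) by (simp only: upd wf_fm.simps)
  qed
  then have "sat N e (Ex n \<phi>) \<longleftrightarrow>
      (\<exists>X\<in>univ N. \<forall>\<^sub>F t in ufilter. sat M ((proj t e)(n := up_rep X t)) \<phi>)"
    by simp
  also have "\<dots> \<longleftrightarrow> (\<forall>\<^sub>F t in ufilter. \<exists>x\<in>univ M. sat M ((proj t e)(n := x)) \<phi>)"
  proof
    assume "\<exists>X\<in>univ N. \<forall>\<^sub>F t in ufilter. sat M ((proj t e)(n := up_rep X t)) \<phi>"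
    then obtain X where X: "X \<in> univ N" "\<forall>\<^sub>F t in ufilter. sat M ((proj t e)(n := up_rep X t)) \<phi>"
      by blast
    from X(2) eventually_index show "\<forall>\<^sub>F t in ufilter. \<exists>x\<in>univ M. sat M ((proj t e)(n := x)) \<phi>"
    proof eventually_elim
      case (elim t)
      then show ?case using up_rep_in[OF X(1)] by blast
    qed
  next
    assume "\<forall>\<^sub>F t in ufilter. \<exists>x\<in>univ M. sat M ((proj t e)(n := x)) \<phi>"
    then show "\<exists>X\<in>univ N. \<forall>\<^sub>F t in ufilter. sat M ((proj t e)(n := up_rep X t)) \<phi>"
      by (rule eventually_choice)
  qed
  finally show ?case by simp
qed

lemma diag_in_univ: "c \<in> univ M \<Longrightarrow> diag I E M c \<in> univ N"
  by (auto simp: diag_def univ_ultrapower)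

lemma up_rep_diag: "c \<in> univ M \<Longrightarrow> \<forall>\<^sub>F t in ufilter. up_rep (diag I E M c) t = c"
  unfolding diag_def
  using up_rep_up_class[of "\<lambda>t\<in>I. c"] eventually_index by (auto elim: eventually_elim2)

text \<open>
  Diagonal parameters are replaced by their values, which is what a formula read in the
  extension with the images of the parameters requires.
\<close>

lemma los_env:
  assumes wf: "wf_fm Lg \<phi>" and fv: "fv \<phi> \<subseteq> {..<length zs + length cs}"
    and zs: "set zs \<subseteq> univ N" and cs: "set cs \<subseteq> univ M"
  shows "sat N (env (zs @ map (diag I E M) cs)) \<phi> \<longleftrightarrow>
    (\<forall>\<^sub>F t in ufilter. sat M (env (map (\<lambda>X. up_rep X t) zs @ cs)) \<phi>)"
proof -
  let ?ws = "zs @ map (diag I E M) cs"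
  have "set ?ws \<subseteq> univ N"
    using zs cs diag_in_univ by auto
  moreover have "env ?ws k \<in> set ?ws" if "k \<in> fv \<phi>" for k
  proof -
    have "k < length ?ws" using fv that by auto
    then show ?thesis unfolding env_def using nth_mem[of k ?ws] by simp
  qed
  ultimately have "env ?ws ` fv \<phi> \<subseteq> univ N" by blast
  note los[OF wf this]
  also have "(\<forall>\<^sub>F t in ufilter. sat M (proj t (env ?ws)) \<phi>) \<longleftrightarrow>
      (\<forall>\<^sub>F t in ufilter. sat M (env (map (\<lambda>X. up_rep X t) zs @ cs)) \<phi>)"
  proof (rule eventually_cong)
    show "\<forall>\<^sub>F t in ufilter. \<forall>c\<in>set cs. up_rep (diag I E M c) t = c"
      using cs up_rep_diag by (intro eventually_ball_finite) auto
    fix t assume t: "\<forall>c\<in>set cs. up_rep (diag I E M c) t = c"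
    show "sat M (proj t (env ?ws)) \<phi> \<longleftrightarrow> sat M (env (map (\<lambda>X. up_rep X t) zs @ cs)) \<phi>"
    proof (rule sat_cong)
      fix k assume "k \<in> fv \<phi>"
      then have "k < length zs + length cs" using fv by auto
      then show "proj t (env ?ws) k = env (map (\<lambda>X. up_rep X t) zs @ cs) k"
        using t by (auto simp: env_def nth_append)
    qed
  qed
  finally show ?thesis .
qed

text \<open>
  Let p be finitely satisfiable in the ultrapower, and well-order p in its cardinality, so that
  proper initial segments have fewer than \<kappa> members. For each j in p,
  \<kappa>-completeness gives a set B j of the ultrafilter on which all finite subsets of the
  initial segment up to j are satisfiable in M. In coordinate t keep only the set S t
  of those j with t \<in> B j. A finite subset of S t is contained in the initial segment of its
  own greatest element, hence is satisfiable in M, and so S t is realized by some element of M.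
  These elements together form a realization of p, because each j is kept on the set B j.
\<close>

lemma ultrapower_realizes_types:
  assumes \<kappa>: "Cinfinite \<kappa>" and complete: "complete_on I \<kappa> E"
    and real: "realizes_types Lg M \<kappa> 1"
  shows "realizes_types Lg N \<kappa> 1"
  unfolding realizes_types_def
proof (intro allI impI, elim conjE)
  fix p :: "(('f, 'r) fm \<times> (nat \<Rightarrow> ('i \<Rightarrow> 'a) set)) set"
  assume p: "|p| \<le>o \<kappa>" "is_type Lg N 1 p"
    and fin: "\<forall>q. finite q \<and> q \<subseteq> p \<longrightarrow> realized N 1 q"
  define R where
    "R q t \<longleftrightarrow> (\<exists>x\<in>univ M. \<forall>\<phi> e. (\<phi>, e) \<in> q \<longrightarrow> sat M ((proj t e)(0 := x)) \<phi>)" for q t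
  have los_upd: "sat N (e(0 := X)) \<phi> \<longleftrightarrow> (\<forall>\<^sub>F t in ufilter. sat M ((proj t e)(0 := up_rep X t)) \<phi>)"
    if "(\<phi>, e) \<in> p" "X \<in> univ N" for \<phi> e X
  proof -
    have upd: "proj t (e(0 := X)) = (proj t e)(0 := up_rep X t)" for t
      by auto
    have "wf_fm Lg \<phi>" "e ` (fv \<phi> - {..<1}) \<subseteq> univ N"
      using p(2) that(1) unfolding is_type_def by blast+
    moreover from this have "(e(0 := X)) ` fv \<phi> \<subseteq> univ N"
      using that(2) by auto
    ultimately show ?thesis
      using los[of \<phi> "e(0 := X)"] unfolding upd by blast
  qed
  have R_finite: "\<forall>\<^sub>F t in ufilter. R q t" if q: "finite q" "q \<subseteq> p" for q
  proof -
    obtain X where X: "X \<in> univ N" "\<forall>\<phi> e. (\<phi>, e) \<in> q \<longrightarrow> sat N (e(0 := X)) \<phi>"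
      using fin q unfolding realized_1 by blast
    have "\<forall>\<^sub>F t in ufilter. \<forall>x\<in>q. sat M ((proj t (snd x))(0 := up_rep X t)) (fst x)"
    proof (intro eventually_ball_finite q(1) ballI)
      fix x assume "x \<in> q"
      then have "(fst x, snd x) \<in> q" by simp
      then show "\<forall>\<^sub>F t in ufilter. sat M ((proj t (snd x))(0 := up_rep X t)) (fst x)"
        using X q(2) los_upd by blast
    qed
    then show ?thesis
      using eventually_index
    proof eventually_elim
      case (elim t)
      have "\<forall>\<phi> e. (\<phi>, e) \<in> q \<longrightarrow> sat M ((proj t e)(0 := up_rep X t)) \<phi>"
        using elim(1) by fastforce
      then show ?case unfolding R_def using up_rep_in[OF X(1) elim(2)] by blast
    qed
  qed
  let ?r = "|p|"
  have Co: "Card_order ?r" and Field: "Field ?r = p"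
    by (simp_all add: card_of_card_order_on Field_card_of)
  have Lin: "Linear_order ?r"
    using Co card_order_on_well_order_on well_order_on_def by blast
  define B where "B j = {t \<in> I. \<forall>q\<in>Fpow (underS ?r j). R (insert j q) t}" for j
  have underS_subset: "underS ?r j \<subseteq> p" for j
    using Field by (auto dest: underS_Field)
  have B: "B j \<in> E" if j: "j \<in> p" for j
  proof -
    let ?G = "(\<lambda>q. {t \<in> I. R (insert j q) t}) ` Fpow (underS ?r j)"
    have "?G \<subseteq> E"
      using R_finite underS_subset[of j] j
      by (auto simp: Fpow_def eventually_ufilter[symmetric])
    moreover have "|underS ?r j| <o \<kappa>"
      using j Field by (intro ordLess_ordLeq_trans[OF card_of_underS[OF Co] p(1)]) simp
    then have "|?G| <o \<kappa>"
      by (rule ordLeq_ordLess_trans[OF card_of_image card_of_Fpow_less[OF \<kappa>]])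
    ultimately have "I \<inter> \<Inter>?G \<in> E"
      using complete unfolding complete_on_def by blast
    moreover have "I \<inter> \<Inter>?G = B j"
      by (auto simp: B_def)
    ultimately show ?thesis by simp
  qed
  define S where "S t = {j \<in> p. t \<in> B j}" for t
  have R_S: "R (S t) t" if t: "t \<in> I" for t
  proof -
    have R_sub: "R q t" if q: "finite q" "q \<subseteq> S t" for q
    proof (cases "q = {}")
      case True
      then show ?thesis
        using struct by (auto simp: R_def is_struct_def)
    next
      case False
      have "q \<subseteq> p" using q by (auto simp: S_def)
      then have "(x, y) \<in> ?r \<or> (y, x) \<in> ?r" if "x \<in> q" "y \<in> q" for x y
        using Lin that Field
        by (metis (no_types, lifting) linear_order_on_def partial_order_onD(1) refl_on_def
          subset_iff total_on_def)
      moreover have "trans ?r"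
        using Lin by (auto simp: linear_order_on_def dest: partial_order_onD)
      ultimately obtain m where m: "m \<in> q" "\<forall>x\<in>q. (x, m) \<in> ?r"
        using finite_chain_has_greatest[of q ?r] q(1) False by blast
      then have "q - {m} \<in> Fpow (underS ?r m)"
        using q by (auto simp: Fpow_def underS_def)
      moreover have "t \<in> B m" using m q by (auto simp: S_def)
      ultimately have "R (insert m (q - {m})) t" by (auto simp: B_def)
      then show ?thesis using m(1) by (simp add: insert_absorb)
    qed
    define h where "h = (\<lambda>(\<phi> :: ('f, 'r) fm, e). (\<phi>, proj t e))"
    have real_h: "realized M 1 (h ` q) \<longleftrightarrow> R q t" for q
    proof -
      have mem: "(\<psi>, e') \<in> h ` q \<longleftrightarrow> (\<exists>e. (\<psi>, e) \<in> q \<and> e' = proj t e)" for \<psi> e'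
        unfolding h_def by (auto intro: image_eqI[rotated])
      have "(\<forall>\<psi> e'. (\<psi>, e') \<in> h ` q \<longrightarrow> sat M (e'(0 := x)) \<psi>) \<longleftrightarrow>
          (\<forall>\<phi> e. (\<phi>, e) \<in> q \<longrightarrow> sat M ((proj t e)(0 := x)) \<phi>)" for x
        unfolding mem by (simp only: imp_ex simp_thms imp_conjL) blast
      then show ?thesis
        unfolding realized_1 R_def by simp
    qed
    have "realized M 1 (h ` S t)"
    proof (rule realizes_typesD[OF real])
      have "h ` S t \<subseteq> h ` p" by (auto simp: S_def)
      then show "|h ` S t| \<le>o \<kappa>"
        using p(1) card_of_image card_of_mono1 ordLeq_transitive by meson
      have "wf_fm Lg \<psi> \<and> e' ` (fv \<psi> - {..<1}) \<subseteq> univ M" if \<psi>: "(\<psi>, e') \<in> h ` S t" for \<psi> e'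
      proof -
        obtain e where e: "(\<psi>, e) \<in> p" "e' = proj t e"
          using \<psi> by (auto simp: h_def S_def)
        then have "wf_fm Lg \<psi>" "e ` (fv \<psi> - {..<1}) \<subseteq> univ N"
          using p(2) unfolding is_type_def by blast+
        then show ?thesis
          using up_rep_in[OF _ t] by (auto simp: e(2))
      qed
      then show "is_type Lg M 1 (h ` S t)"
        unfolding is_type_def by blast
      fix q' assume q': "finite q'" "q' \<subseteq> h ` S t"
      obtain q where "q \<subseteq> S t" "finite q" "q' = h ` q"
        using finite_subset_image[OF q'] by blast
      then show "realized M 1 q'" using R_sub by (simp add: real_h del: One_nat_def)
    qed
    then show ?thesis by (simp only: real_h)
  qed
  have "\<forall>\<^sub>F t in ufilter. \<exists>x\<in>univ M. \<forall>\<phi> e. (\<phi>, e) \<in> S t \<longrightarrow> sat M ((proj t e)(0 := x)) \<phi>"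
    using eventually_index by (rule eventually_mono) (use R_S in \<open>simp add: R_def\<close>)
  then obtain X where X: "X \<in> univ N"
    "\<forall>\<^sub>F t in ufilter. \<forall>\<phi> e. (\<phi>, e) \<in> S t \<longrightarrow> sat M ((proj t e)(0 := up_rep X t)) \<phi>"
    by (elim eventually_choice[THEN bexE])
  have "sat N (e(0 := X)) \<phi>" if "(\<phi>, e) \<in> p" for \<phi> e
  proof -
    have "{t \<in> I. t \<in> B (\<phi>, e)} = B (\<phi>, e)" by (auto simp: B_def)
    then have "\<forall>\<^sub>F t in ufilter. t \<in> B (\<phi>, e)"
      using B[OF that] by (simp add: eventually_ufilter)
    then have "\<forall>\<^sub>F t in ufilter. sat M ((proj t e)(0 := up_rep X t)) \<phi>"
      using X(2) by eventually_elim (use that in \<open>auto simp: S_def\<close>)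
    then show ?thesis using los_upd[OF that X(1)] by blast
  qed
  then show "realized N 1 p"
    unfolding realized_1 using X(1) by blast
qed

end


section \<open>Interpreted partial orders\<close>

definition tuple_le ::
    "('f, 'r, 'a) struct \<Rightarrow> ('f, 'r) interp \<Rightarrow> 'a list \<Rightarrow> 'a list \<Rightarrow> 'a list \<Rightarrow> bool" where
  "tuple_le M \<Gamma> cs xs ys \<longleftrightarrow> sat M (env (xs @ ys @ cs)) (le_fm \<Gamma>)"

text \<open>
  For a preorder whose equivalence is eq_fm, all requirements on eq_fm (it is an equivalence
  relation and a congruence for le_fm) follow. In this form an interpreted partial order
  is described by universal conditions on tuples, which transfer to ultrapowers coordinatewise.
\<close>

definition tuple_order ::
    "('f, 'r, 'a) struct \<Rightarrow> ('f, 'r) interp \<Rightarrow> 'a list \<Rightarrow> bool" where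
  "tuple_order M \<Gamma> cs \<longleftrightarrow>
     (\<forall>xs\<in>int_dom M \<Gamma> cs. tuple_le M \<Gamma> cs xs xs) \<and>
     (\<forall>xs\<in>int_dom M \<Gamma> cs. \<forall>ys\<in>int_dom M \<Gamma> cs. \<forall>zs\<in>int_dom M \<Gamma> cs.
        tuple_le M \<Gamma> cs xs ys \<longrightarrow> tuple_le M \<Gamma> cs ys zs \<longrightarrow> tuple_le M \<Gamma> cs xs zs) \<and>
     (\<forall>xs\<in>int_dom M \<Gamma> cs. \<forall>ys\<in>int_dom M \<Gamma> cs.
        sat M (env (xs @ ys @ cs)) (eq_fm \<Gamma>) \<longleftrightarrow> tuple_le M \<Gamma> cs xs ys \<and> tuple_le M \<Gamma> cs ys xs)"

lemma int_le_iff_tuple_le: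
  assumes equiv: "equiv (int_dom M \<Gamma> cs) (int_eq M \<Gamma> cs)"
    and cong: "\<And>xs xs' ys ys'. (xs, xs') \<in> int_eq M \<Gamma> cs \<Longrightarrow> (ys, ys') \<in> int_eq M \<Gamma> cs \<Longrightarrow>
      tuple_le M \<Gamma> cs xs' ys' \<Longrightarrow> tuple_le M \<Gamma> cs xs ys"
    and xs: "xs \<in> int_dom M \<Gamma> cs" and ys: "ys \<in> int_dom M \<Gamma> cs"
  shows "(int_eq M \<Gamma> cs `` {xs}, int_eq M \<Gamma> cs `` {ys}) \<in> int_le M \<Gamma> cs \<longleftrightarrow> tuple_le M \<Gamma> cs xs ys"
proof
  assume "(int_eq M \<Gamma> cs `` {xs}, int_eq M \<Gamma> cs `` {ys}) \<in> int_le M \<Gamma> cs"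
  then obtain xs' ys' where "(xs, xs') \<in> int_eq M \<Gamma> cs" "(ys, ys') \<in> int_eq M \<Gamma> cs"
    "tuple_le M \<Gamma> cs xs' ys'"
    by (auto simp: int_le_def tuple_le_def)
  then show "tuple_le M \<Gamma> cs xs ys" by (rule cong)
next
  assume "tuple_le M \<Gamma> cs xs ys"
  moreover have "xs \<in> int_eq M \<Gamma> cs `` {xs}" "ys \<in> int_eq M \<Gamma> cs `` {ys}"
    using equiv_class_self[OF equiv] xs ys by blast+
  moreover have "int_eq M \<Gamma> cs `` {xs} \<in> int_univ M \<Gamma> cs" "int_eq M \<Gamma> cs `` {ys} \<in> int_univ M \<Gamma> cs"
    using xs ys by (auto simp: int_univ_def intro: quotientI)
  ultimately show "(int_eq M \<Gamma> cs `` {xs}, int_eq M \<Gamma> cs `` {ys}) \<in> int_le M \<Gamma> cs"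
    unfolding int_le_def tuple_le_def by blast
qed

lemma tuple_order_if_partial_order:
  assumes interp: "is_interp Lg M \<Gamma> cs"
    and po: "partial_order_on (int_univ M \<Gamma> cs) (int_le M \<Gamma> cs)"
  shows "tuple_order M \<Gamma> cs"
proof -
  let ?D = "int_dom M \<Gamma> cs" and ?eq = "int_eq M \<Gamma> cs"
  have equiv: "equiv ?D ?eq" using interp by (simp add: is_interp_def)
  have le_iff: "(?eq `` {xs}, ?eq `` {ys}) \<in> int_le M \<Gamma> cs \<longleftrightarrow> tuple_le M \<Gamma> cs xs ys"
    if "xs \<in> ?D" "ys \<in> ?D" for xs ys
  proof (rule int_le_iff_tuple_le[OF equiv _ that])
    show "tuple_le M \<Gamma> cs xs ys"
      if "(xs, xs') \<in> ?eq" "(ys, ys') \<in> ?eq" "tuple_le M \<Gamma> cs xs' ys'" for xs xs' ys ys'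
      using interp that unfolding is_interp_def tuple_le_def by blast
  qed
  have cls: "?eq `` {xs} \<in> int_univ M \<Gamma> cs" if "xs \<in> ?D" for xs
    using that by (auto simp: int_univ_def intro: quotientI)
  have refl: "tuple_le M \<Gamma> cs xs xs" if "xs \<in> ?D" for xs
    using refl_onD[OF partial_order_onD(1)[OF po] cls[OF that]] le_iff[OF that that] by blast
  have trans: "tuple_le M \<Gamma> cs xs zs"
    if "xs \<in> ?D" "ys \<in> ?D" "zs \<in> ?D" "tuple_le M \<Gamma> cs xs ys" "tuple_le M \<Gamma> cs ys zs" for xs ys zs
    using transD[OF partial_order_onD(2)[OF po]] that le_iff by blast
  have antisym: "sat M (env (xs @ ys @ cs)) (eq_fm \<Gamma>) \<longleftrightarrow>
      tuple_le M \<Gamma> cs xs ys \<and> tuple_le M \<Gamma> cs ys xs"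
    if "xs \<in> ?D" "ys \<in> ?D" for xs ys
  proof -
    have "sat M (env (xs @ ys @ cs)) (eq_fm \<Gamma>) \<longleftrightarrow> (xs, ys) \<in> ?eq"
      using that by (simp add: int_eq_def)
    also have "\<dots> \<longleftrightarrow> ?eq `` {xs} = ?eq `` {ys}"
      using eq_equiv_class_iff[OF equiv that] by simp
    also have "\<dots> \<longleftrightarrow> tuple_le M \<Gamma> cs xs ys \<and> tuple_le M \<Gamma> cs ys xs"
    proof
      assume "?eq `` {xs} = ?eq `` {ys}"
      then show "tuple_le M \<Gamma> cs xs ys \<and> tuple_le M \<Gamma> cs ys xs"
        using le_iff[OF that] le_iff[OF that(2,1)] le_iff[OF that(1,1)] refl[OF that(1)] by simp
    next
      assume "tuple_le M \<Gamma> cs xs ys \<and> tuple_le M \<Gamma> cs ys xs"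
      then show "?eq `` {xs} = ?eq `` {ys}"
        using antisymD[OF partial_order_onD(3)[OF po]] le_iff[OF that] le_iff[OF that(2,1)] by blast
    qed
    finally show ?thesis .
  qed
  show ?thesis
    unfolding tuple_order_def using refl trans antisym by blast
qed

lemma tuple_order_quotient:
  assumes ord: "tuple_order M \<Gamma> cs"
  shows "\<And>xs ys. xs \<in> int_dom M \<Gamma> cs \<Longrightarrow> ys \<in> int_dom M \<Gamma> cs \<Longrightarrow>
      (int_eq M \<Gamma> cs `` {xs}, int_eq M \<Gamma> cs `` {ys}) \<in> int_le M \<Gamma> cs \<longleftrightarrow> tuple_le M \<Gamma> cs xs ys"
    and "partial_order_on (int_univ M \<Gamma> cs) (int_le M \<Gamma> cs)"
proof -
  let ?D = "int_dom M \<Gamma> cs" and ?eq = "int_eq M \<Gamma> cs"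
  have refl: "tuple_le M \<Gamma> cs xs xs" if "xs \<in> ?D" for xs
    using ord that by (simp add: tuple_order_def)
  have trans: "tuple_le M \<Gamma> cs xs zs"
    if "xs \<in> ?D" "ys \<in> ?D" "zs \<in> ?D" "tuple_le M \<Gamma> cs xs ys" "tuple_le M \<Gamma> cs ys zs" for xs ys zs
    using ord that unfolding tuple_order_def by blast
  have eq: "(xs, ys) \<in> ?eq \<longleftrightarrow>
      xs \<in> ?D \<and> ys \<in> ?D \<and> tuple_le M \<Gamma> cs xs ys \<and> tuple_le M \<Gamma> cs ys xs" for xs ys
    using ord unfolding int_eq_def tuple_order_def by blast
  have equiv: "equiv ?D ?eq"
  proof (rule equivI)
    show "?eq \<subseteq> ?D \<times> ?D" using eq by auto
    show "refl_on ?D ?eq" using eq refl by (auto intro!: refl_onI)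
    show "sym ?eq" using eq by (auto intro!: symI)
    show "trans ?eq" by (rule transI) (use eq trans in blast)
  qed
  show le_iff: "(?eq `` {xs}, ?eq `` {ys}) \<in> int_le M \<Gamma> cs \<longleftrightarrow> tuple_le M \<Gamma> cs xs ys"
    if "xs \<in> ?D" "ys \<in> ?D" for xs ys
  proof (rule int_le_iff_tuple_le[OF equiv _ that])
    show "tuple_le M \<Gamma> cs xs ys"
      if "(xs, xs') \<in> ?eq" "(ys, ys') \<in> ?eq" "tuple_le M \<Gamma> cs xs' ys'" for xs xs' ys ys'
      using that eq trans by meson
  qed
  have rep: "\<exists>xs\<in>?D. X = ?eq `` {xs}" if "X \<in> int_univ M \<Gamma> cs" for X
    using that by (auto simp: int_univ_def elim: quotientE)
  show "partial_order_on (int_univ M \<Gamma> cs) (int_le M \<Gamma> cs)"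
    unfolding partial_order_on_def preorder_on_def
  proof (intro conjI)
    have sub: "int_le M \<Gamma> cs \<subseteq> int_univ M \<Gamma> cs \<times> int_univ M \<Gamma> cs"
      by (auto simp: int_le_def)
    then show "int_le M \<Gamma> cs \<subseteq> int_univ M \<Gamma> cs \<times> int_univ M \<Gamma> cs" .
    show "refl_on (int_univ M \<Gamma> cs) (int_le M \<Gamma> cs)"
    proof (rule refl_onI)
      fix X assume "X \<in> int_univ M \<Gamma> cs"
      then obtain xs where "xs \<in> ?D" "X = ?eq `` {xs}" using rep by blast
      then show "(X, X) \<in> int_le M \<Gamma> cs" using le_iff refl by simp
    qed
    show "trans (int_le M \<Gamma> cs)"
    proof (rule transI)
      fix X Y Z assume *: "(X, Y) \<in> int_le M \<Gamma> cs" "(Y, Z) \<in> int_le M \<Gamma> cs"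
      then have "X \<in> int_univ M \<Gamma> cs" "Y \<in> int_univ M \<Gamma> cs" "Z \<in> int_univ M \<Gamma> cs"
        using sub by blast+
      then obtain xs ys zs where **: "xs \<in> ?D" "ys \<in> ?D" "zs \<in> ?D"
        "X = ?eq `` {xs}" "Y = ?eq `` {ys}" "Z = ?eq `` {zs}"
        using rep by meson
      then have "tuple_le M \<Gamma> cs xs zs"
        using * le_iff by (intro trans[of xs ys zs]) simp_all
      then show "(X, Z) \<in> int_le M \<Gamma> cs"
        using ** le_iff by simp
    qed
    show "antisym (int_le M \<Gamma> cs)"
    proof (rule antisymI)
      fix X Y assume *: "(X, Y) \<in> int_le M \<Gamma> cs" "(Y, X) \<in> int_le M \<Gamma> cs"
      then have "X \<in> int_univ M \<Gamma> cs" "Y \<in> int_univ M \<Gamma> cs"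
        using sub by blast+
      then obtain xs ys where **: "xs \<in> ?D" "ys \<in> ?D" "X = ?eq `` {xs}" "Y = ?eq `` {ys}"
        using rep by meson
      then have "(xs, ys) \<in> ?eq"
        using * le_iff eq by simp
      then show "X = Y"
        using ** equiv_class_eq[OF equiv] by simp
    qed
  qed
qed

context struct_ultrafilter
begin

text \<open>
  Each condition is a universal implication between instances of le_fm and eq_fm. It holds in the
  coordinates in which all the tuples concerned lie in the domain, and these are almost all.
\<close>

lemma tuple_order_ultrapower:
  assumes interp: "is_interp Lg M \<Gamma> cs" and ord: "tuple_order M \<Gamma> cs"
  shows "tuple_order N \<Gamma> (map (diag I E M) cs)"
proof -
  let ?ds = "map (diag I E M) cs" and ?p = "\<lambda>t. map (\<lambda>X. up_rep X t)"
  have cs: "set cs \<subseteq> univ M"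
    and fm: "wf_fm Lg (dom_fm \<Gamma>)" "fv (dom_fm \<Gamma>) \<subseteq> {..<dim \<Gamma> + length cs}"
      "wf_fm Lg (eq_fm \<Gamma>)" "fv (eq_fm \<Gamma>) \<subseteq> {..<2 * dim \<Gamma> + length cs}"
      "wf_fm Lg (le_fm \<Gamma>)" "fv (le_fm \<Gamma>) \<subseteq> {..<2 * dim \<Gamma> + length cs}"
    using interp by (simp_all add: is_interp_def)
  have dom: "\<forall>\<^sub>F t in ufilter. ?p t xs \<in> int_dom M \<Gamma> cs" if "xs \<in> int_dom N \<Gamma> ?ds" for xs
  proof -
    have xs: "length xs = dim \<Gamma>" "set xs \<subseteq> univ N" "sat N (env (xs @ ?ds)) (dom_fm \<Gamma>)"
      using that by (simp_all add: int_dom_def)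
    then have "\<forall>\<^sub>F t in ufilter. sat M (env (?p t xs @ cs)) (dom_fm \<Gamma>)"
      using los_env[OF fm(1) _ xs(2) cs] fm(2) by simp
    then show ?thesis
      using eventually_index
    proof eventually_elim
      case (elim t)
      have "set (?p t xs) \<subseteq> univ M" using xs(2) up_rep_in[OF _ elim(2)] by auto
      then show ?case using elim(1) xs(1) by (simp add: int_dom_def)
    qed
  qed
  have two: "sat N (env (xs @ ys @ ?ds)) \<phi> \<longleftrightarrow> (\<forall>\<^sub>F t in ufilter. sat M (env (?p t xs @ ?p t ys @ cs)) \<phi>)"
    if "wf_fm Lg \<phi>" "fv \<phi> \<subseteq> {..<2 * dim \<Gamma> + length cs}"
      "xs \<in> int_dom N \<Gamma> ?ds" "ys \<in> int_dom N \<Gamma> ?ds" for xs ys \<phi>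
    using los_env[OF that(1) _ _ cs, of "xs @ ys"] that(2-4) by (simp add: int_dom_def mult_2)
  note le = two[OF fm(5,6), folded tuple_le_def] and eq = two[OF fm(3,4)]
  show ?thesis
    unfolding tuple_order_def
  proof (intro conjI ballI impI)
    fix xs assume xs: "xs \<in> int_dom N \<Gamma> ?ds"
    show "tuple_le N \<Gamma> ?ds xs xs"
      unfolding le[OF xs xs] using dom[OF xs]
      by eventually_elim (use ord in \<open>simp add: tuple_order_def\<close>)
    fix ys assume ys: "ys \<in> int_dom N \<Gamma> ?ds"
    show "sat N (env (xs @ ys @ ?ds)) (eq_fm \<Gamma>) \<longleftrightarrow> tuple_le N \<Gamma> ?ds xs ys \<and> tuple_le N \<Gamma> ?ds ys xs"
      unfolding le[OF xs ys] le[OF ys xs] eq[OF xs ys] eventually_conj_iff[symmetric]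
      by (rule eventually_cong[OF eventually_conj[OF dom[OF xs] dom[OF ys]]])
        (use ord in \<open>simp add: tuple_order_def\<close>)
    fix zs assume zs: "zs \<in> int_dom N \<Gamma> ?ds"
    assume "tuple_le N \<Gamma> ?ds xs ys" "tuple_le N \<Gamma> ?ds ys zs"
    then show "tuple_le N \<Gamma> ?ds xs zs"
      unfolding le[OF xs ys] le[OF ys zs] le[OF xs zs] using dom[OF xs] dom[OF ys] dom[OF zs]
      by eventually_elim (use ord in \<open>unfold tuple_order_def, blast\<close>)
  qed
qed

end


section \<open>Orders in which small sets have bounds\<close>

text \<open>
  The only types that matter for cuts and branches: those that ask for a point above A and below B.
\<close>

definition order_compact :: "'b set \<Rightarrow> 'b rel \<Rightarrow> 'k rel \<Rightarrow> bool" where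
  "order_compact X r \<kappa> \<longleftrightarrow>
     (\<forall>A B. A \<subseteq> X \<and> B \<subseteq> X \<and> |A| \<le>o \<kappa> \<and> |B| \<le>o \<kappa> \<and>
        (\<forall>A' B'. finite A' \<and> A' \<subseteq> A \<and> finite B' \<and> B' \<subseteq> B \<longrightarrow>
           (\<exists>x\<in>X. (\<forall>a\<in>A'. (a, x) \<in> r) \<and> (\<forall>b\<in>B'. (x, b) \<in> r))) \<longrightarrow>
        (\<exists>x\<in>X. (\<forall>a\<in>A. (a, x) \<in> r) \<and> (\<forall>b\<in>B. (x, b) \<in> r)))"

text \<open>
  The type consists of dom_fm, of x \<le> b for the elements b of B, which is le_fm itself with the
  unknowns in the first block of variables, and of a \<le> x for the elements a of A. In the latter
  the unknowns of le_fm are in the second block, so \<tau> exchanges the two blocks.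
\<close>

lemma tuples_compact:
  fixes M :: "('f, 'r, 'a) struct"
  assumes \<kappa>: "Cinfinite \<kappa>" and real: "realizes_types Lg M \<kappa> (dim \<Gamma>)"
    and cs: "set cs \<subseteq> univ M"
    and dom_fm: "wf_fm Lg (dom_fm \<Gamma>)" "fv (dom_fm \<Gamma>) \<subseteq> {..<dim \<Gamma> + length cs}"
    and le_fm: "wf_fm Lg (le_fm \<Gamma>)" "fv (le_fm \<Gamma>) \<subseteq> {..<2 * dim \<Gamma> + length cs}"
    and A: "A \<subseteq> int_dom M \<Gamma> cs" "|A| \<le>o \<kappa>" and B: "B \<subseteq> int_dom M \<Gamma> cs" "|B| \<le>o \<kappa>"
    and fin: "\<And>A' B'. finite A' \<Longrightarrow> A' \<subseteq> A \<Longrightarrow> finite B' \<Longrightarrow> B' \<subseteq> B \<Longrightarrow>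
      \<exists>x\<in>int_dom M \<Gamma> cs. (\<forall>a\<in>A'. tuple_le M \<Gamma> cs a x) \<and> (\<forall>b\<in>B'. tuple_le M \<Gamma> cs x b)"
  shows "\<exists>x\<in>int_dom M \<Gamma> cs. (\<forall>a\<in>A. tuple_le M \<Gamma> cs a x) \<and> (\<forall>b\<in>B. tuple_le M \<Gamma> cs x b)"
proof -
  let ?n = "dim \<Gamma>"
  \<comment> \<open>The entries of us stand where the unknowns go, and are overwritten.\<close>
  define us where "us = replicate ?n (undefined :: 'a)"
  define \<tau> where "\<tau> k = (if k < ?n then ?n + k else if k < 2 * ?n then k - ?n else k)" for k
  have inj: "inj \<tau>"
    by (auto simp: \<tau>_def inj_def split: if_splits)
  define d where "d = (dom_fm \<Gamma>, env (us @ cs))"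
  define lo where "lo a = (rename \<tau> (le_fm \<Gamma>), env (us @ a @ cs))" for a
  define up where "up b = (le_fm \<Gamma>, env (us @ b @ cs))" for b
  define holds where "holds x c \<longleftrightarrow> sat M (over ?n (\<lambda>k. x ! k) (snd c)) (fst c)"
    for x :: "'a list" and c :: "('f, 'r) fm \<times> (nat \<Rightarrow> 'a)"
  have over: "over ?n (\<lambda>k. x ! k) (env (us @ ys)) = env (x @ ys)" if "length x = ?n" for x ys
    using that by (auto simp: over_def env_def us_def nth_append fun_eq_iff)
  have holds_d: "holds x d \<longleftrightarrow> x \<in> int_dom M \<Gamma> cs" if "length x = ?n" "set x \<subseteq> univ M" for x
    using that by (simp add: holds_def d_def over int_dom_def)
  have holds_up: "holds x (up b) \<longleftrightarrow> tuple_le M \<Gamma> cs x b" if "length x = ?n" for x b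
    using that by (simp add: holds_def up_def over tuple_le_def)
  have holds_lo: "holds x (lo a) \<longleftrightarrow> tuple_le M \<Gamma> cs a x" if "length x = ?n" "length a = ?n" for x a
  proof -
    have "env (x @ a @ cs) \<circ> \<tau> = env (a @ x @ cs)"
      using that by (auto simp: env_def \<tau>_def nth_append fun_eq_iff)
    then show ?thesis
      using that(1) by (simp add: holds_def lo_def over sat_rename[OF inj] tuple_le_def)
  qed
  have real_iff: "realized M ?n q \<longleftrightarrow>
      (\<exists>x. length x = ?n \<and> set x \<subseteq> univ M \<and> (\<forall>c\<in>q. holds x c))" for q
  proof
    assume "realized M ?n q"
    then obtain g where g: "g ` {..<?n} \<subseteq> univ M" "\<forall>\<phi> e. (\<phi>, e) \<in> q \<longrightarrow> sat M (over ?n g e) \<phi>"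
      by (rule realizedE)
    have "over ?n (\<lambda>k. map g [0..<?n] ! k) e = over ?n g e" for e
      by (auto simp: over_def)
    then have "\<forall>c\<in>q. holds (map g [0..<?n]) c"
      using g(2) by (auto simp: holds_def)
    moreover have "set (map g [0..<?n]) \<subseteq> univ M" using g(1) by auto
    ultimately show "\<exists>x. length x = ?n \<and> set x \<subseteq> univ M \<and> (\<forall>c\<in>q. holds x c)"
      by (intro exI[of _ "map g [0..<?n]"]) simp
  next
    assume "\<exists>x. length x = ?n \<and> set x \<subseteq> univ M \<and> (\<forall>c\<in>q. holds x c)"
    then obtain x where x: "length x = ?n" "set x \<subseteq> univ M" "\<forall>c\<in>q. holds x c" by blast
    show "realized M ?n q"
    proof (rule realizedI)
      show "(\<lambda>k. x ! k) ` {..<?n} \<subseteq> univ M" using x(1,2) by (auto simp: subset_iff)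
      show "sat M (over ?n (\<lambda>k. x ! k) e) \<phi>" if "(\<phi>, e) \<in> q" for \<phi> e
        using x(3) that by (force simp: holds_def)
    qed
  qed
  define p where "p = insert d (lo ` A \<union> up ` B)"
  have len: "length x = ?n" "set x \<subseteq> univ M" if "x \<in> int_dom M \<Gamma> cs" for x
    using that by (simp_all add: int_dom_def)
  have params: "env (us @ ys) ` (V - {..<?n}) \<subseteq> univ M"
    if "set ys \<subseteq> univ M" "V \<subseteq> {..<?n + length ys}" for ys V
  proof (rule image_subsetI)
    fix k assume k: "k \<in> V - {..<?n}"
    then have "k < ?n + length ys" "?n \<le> k" using that(2) by auto
    then have "env (us @ ys) k = ys ! (k - ?n)" "k - ?n < length ys"
      by (auto simp: env_def us_def nth_append)
    then show "env (us @ ys) k \<in> univ M" using that(1) by (auto simp: subset_iff)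
  qed
  have "realized M ?n p"
  proof (rule realizes_typesD[OF real])
    have "|{d}| \<le>o \<kappa>"
      by (intro ordLess_imp_ordLeq finite_ordLess_Cinfinite[OF \<kappa>]) simp
    moreover have "|lo ` A| \<le>o \<kappa>" "|up ` B| \<le>o \<kappa>"
      using A(2) B(2) card_of_image ordLeq_transitive by blast+
    ultimately have "|{d} \<union> (lo ` A \<union> up ` B)| \<le>o \<kappa>"
      using \<kappa> by (intro Un_Cinfinite_bound)
    then show "|p| \<le>o \<kappa>" by (simp add: p_def)
  next
    have "is_type Lg M ?n {d}"
      unfolding d_def is_type_insert using dom_fm params[OF cs dom_fm(2)] by (simp add: is_type_empty)
    moreover have "is_type Lg M ?n {lo a}" if "a \<in> A" for a
    proof -
      have a: "length a = ?n" "set a \<subseteq> univ M" using that A(1) len by auto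
      have "fv (rename \<tau> (le_fm \<Gamma>)) \<subseteq> {..<?n + length (a @ cs)}"
        using le_fm(2) a(1) unfolding fv_rename[OF inj] by (auto simp: \<tau>_def)
      then show ?thesis
        unfolding lo_def is_type_insert using le_fm(1) a(2) cs params[of "a @ cs"]
        by (simp add: wf_rename is_type_empty)
    qed
    moreover have "is_type Lg M ?n {up b}" if "b \<in> B" for b
    proof -
      have b: "length b = ?n" "set b \<subseteq> univ M" using that B(1) len by auto
      then have "fv (le_fm \<Gamma>) \<subseteq> {..<?n + length (b @ cs)}"
        using le_fm(2) by (simp add: mult_2 add.assoc)
      then show ?thesis
        unfolding up_def is_type_insert using le_fm(1) b(2) cs params[of "b @ cs"]
        by (simp add: is_type_empty)
    qed
    ultimately show "is_type Lg M ?n p"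
      unfolding is_type_def p_def by blast
  next
    fix q assume q: "finite q" "q \<subseteq> p"
    have "finite (q \<inter> lo ` A)" "q \<inter> lo ` A \<subseteq> lo ` A" using q(1) by auto
    from finite_subset_image[OF this] obtain A' where A': "A' \<subseteq> A" "finite A'" "q \<inter> lo ` A = lo ` A'"
      by blast
    have "finite (q \<inter> up ` B)" "q \<inter> up ` B \<subseteq> up ` B" using q(1) by auto
    from finite_subset_image[OF this] obtain B' where B': "B' \<subseteq> B" "finite B'" "q \<inter> up ` B = up ` B'"
      by blast
    obtain x where x: "x \<in> int_dom M \<Gamma> cs" "\<forall>a\<in>A'. tuple_le M \<Gamma> cs a x" "\<forall>b\<in>B'. tuple_le M \<Gamma> cs x b"
      using fin[OF A'(2,1) B'(2,1)] by blast
    have "q \<subseteq> insert d (lo ` A' \<union> up ` B')"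
      using q(2) A'(3) B'(3) unfolding p_def by blast
    moreover have "holds x d" using x(1) holds_d len by blast
    moreover have "holds x (lo a)" if "a \<in> A'" for a
      using x that A'(1) A(1) holds_lo len by blast
    moreover have "holds x (up b)" if "b \<in> B'" for b
      using x that holds_up len by blast
    ultimately have "\<forall>c\<in>q. holds x c" by blast
    then show "realized M ?n q"
      unfolding real_iff using len x(1) by blast
  qed
  then obtain x where x: "length x = ?n" "set x \<subseteq> univ M" "\<forall>c\<in>p. holds x c"
    unfolding real_iff by blast
  then have "x \<in> int_dom M \<Gamma> cs" using holds_d by (simp add: p_def)
  moreover have "tuple_le M \<Gamma> cs a x" if "a \<in> A" for a
  proof -
    have "length a = ?n" using that A(1) len by blast
    from holds_lo[OF x(1) this] show ?thesis using x(3) that unfolding p_def by blast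
  qed
  moreover have "tuple_le M \<Gamma> cs x b" if "b \<in> B" for b
    using holds_up[OF x(1)] x(3) that unfolding p_def by blast
  ultimately show ?thesis by blast
qed

lemma order_compact_interp:
  fixes M :: "('f, 'r, 'a) struct"
  assumes \<kappa>: "Cinfinite \<kappa>" and real: "realizes_types Lg M \<kappa> (dim \<Gamma>)"
    and cs: "set cs \<subseteq> univ M"
    and dom_fm: "wf_fm Lg (dom_fm \<Gamma>)" "fv (dom_fm \<Gamma>) \<subseteq> {..<dim \<Gamma> + length cs}"
    and le_fm: "wf_fm Lg (le_fm \<Gamma>)" "fv (le_fm \<Gamma>) \<subseteq> {..<2 * dim \<Gamma> + length cs}"
    and ord: "tuple_order M \<Gamma> cs"
  shows "order_compact (int_univ M \<Gamma> cs) (int_le M \<Gamma> cs) \<kappa>"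
  unfolding order_compact_def
proof (intro allI impI, elim conjE)
  fix A B
  assume AB: "A \<subseteq> int_univ M \<Gamma> cs" "B \<subseteq> int_univ M \<Gamma> cs" and card: "|A| \<le>o \<kappa>" "|B| \<le>o \<kappa>"
    and fin: "\<forall>A' B'. finite A' \<and> A' \<subseteq> A \<and> finite B' \<and> B' \<subseteq> B \<longrightarrow>
      (\<exists>x\<in>int_univ M \<Gamma> cs. (\<forall>a\<in>A'. (a, x) \<in> int_le M \<Gamma> cs) \<and> (\<forall>b\<in>B'. (x, b) \<in> int_le M \<Gamma> cs))"
  define cls where "cls xs = int_eq M \<Gamma> cs `` {xs}" for xs
  have le_iff: "(cls xs, cls ys) \<in> int_le M \<Gamma> cs \<longleftrightarrow> tuple_le M \<Gamma> cs xs ys"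
    if "xs \<in> int_dom M \<Gamma> cs" "ys \<in> int_dom M \<Gamma> cs" for xs ys
    unfolding cls_def by (rule tuple_order_quotient(1)[OF ord that])
  have univ: "int_univ M \<Gamma> cs = cls ` int_dom M \<Gamma> cs"
    by (auto simp: int_univ_def quotient_def cls_def)
  define \<rho> where "\<rho> X = (SOME xs. xs \<in> int_dom M \<Gamma> cs \<and> X = cls xs)" for X
  have \<rho>: "\<rho> X \<in> int_dom M \<Gamma> cs" "cls (\<rho> X) = X" if "X \<in> int_univ M \<Gamma> cs" for X
  proof -
    have "\<exists>xs. xs \<in> int_dom M \<Gamma> cs \<and> X = cls xs" using that univ by auto
    from someI_ex[OF this] show "\<rho> X \<in> int_dom M \<Gamma> cs" "cls (\<rho> X) = X"
      unfolding \<rho>_def by simp_all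
  qed
  have "\<exists>x\<in>int_dom M \<Gamma> cs. (\<forall>a\<in>\<rho> ` A. tuple_le M \<Gamma> cs a x) \<and> (\<forall>b\<in>\<rho> ` B. tuple_le M \<Gamma> cs x b)"
  proof (rule tuples_compact[OF \<kappa> real cs dom_fm le_fm])
    show "\<rho> ` A \<subseteq> int_dom M \<Gamma> cs" "\<rho> ` B \<subseteq> int_dom M \<Gamma> cs"
      using AB \<rho>(1) by blast+
    show "|\<rho> ` A| \<le>o \<kappa>" "|\<rho> ` B| \<le>o \<kappa>"
      using card card_of_image ordLeq_transitive by blast+
    fix A' B' assume A': "finite A'" "A' \<subseteq> \<rho> ` A" and B': "finite B'" "B' \<subseteq> \<rho> ` B"
    obtain A0 where A0: "A0 \<subseteq> A" "finite A0" "A' = \<rho> ` A0" using finite_subset_image[OF A'] by blast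
    obtain B0 where B0: "B0 \<subseteq> B" "finite B0" "B' = \<rho> ` B0" using finite_subset_image[OF B'] by blast
    have "finite A0 \<and> A0 \<subseteq> A \<and> finite B0 \<and> B0 \<subseteq> B" using A0 B0 by blast
    from fin[rule_format, OF this] obtain X where X: "X \<in> int_univ M \<Gamma> cs"
      "\<forall>a\<in>A0. (a, X) \<in> int_le M \<Gamma> cs" "\<forall>b\<in>B0. (X, b) \<in> int_le M \<Gamma> cs"
      by (elim bexE conjE) (rule that)
    have "tuple_le M \<Gamma> cs (\<rho> a) (\<rho> X)" if "a \<in> A0" for a
    proof -
      have "a \<in> int_univ M \<Gamma> cs" using that A0(1) AB(1) by blast
      then show ?thesis using le_iff[of "\<rho> a" "\<rho> X"] \<rho> X(1,2) that by simp
    qed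
    moreover have "tuple_le M \<Gamma> cs (\<rho> X) (\<rho> b)" if "b \<in> B0" for b
    proof -
      have "b \<in> int_univ M \<Gamma> cs" using that B0(1) AB(2) by blast
      then show ?thesis using le_iff[of "\<rho> X" "\<rho> b"] \<rho> X(1,3) that by simp
    qed
    ultimately show "\<exists>x\<in>int_dom M \<Gamma> cs.
        (\<forall>a\<in>A'. tuple_le M \<Gamma> cs a x) \<and> (\<forall>b\<in>B'. tuple_le M \<Gamma> cs x b)"
      using \<rho>(1)[OF X(1)] unfolding A0(3) B0(3) by blast
  qed
  then obtain x where x: "x \<in> int_dom M \<Gamma> cs"
    "\<forall>a\<in>\<rho> ` A. tuple_le M \<Gamma> cs a x" "\<forall>b\<in>\<rho> ` B. tuple_le M \<Gamma> cs x b"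
    by (elim bexE conjE) (rule that)
  have "(a, cls x) \<in> int_le M \<Gamma> cs" if "a \<in> A" for a
  proof -
    have "a \<in> int_univ M \<Gamma> cs" using that AB(1) by blast
    then show ?thesis using le_iff[of "\<rho> a" x] \<rho> x(1,2) that by simp
  qed
  moreover have "(cls x, b) \<in> int_le M \<Gamma> cs" if "b \<in> B" for b
  proof -
    have "b \<in> int_univ M \<Gamma> cs" using that AB(2) by blast
    then show ?thesis using le_iff[of x "\<rho> b"] \<rho> x(1,3) that by simp
  qed
  moreover have "cls x \<in> int_univ M \<Gamma> cs" using x(1) univ by blast
  ultimately show "\<exists>x\<in>int_univ M \<Gamma> cs.
      (\<forall>a\<in>A. (a, x) \<in> int_le M \<Gamma> cs) \<and> (\<forall>b\<in>B. (x, b) \<in> int_le M \<Gamma> cs)"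
    by blast
qed

lemma image_Field_le:
  assumes "Card_order \<theta>" "\<theta> \<le>o \<kappa>"
  shows "|f ` Field \<theta>| \<le>o \<kappa>"
proof -
  have "|Field \<theta>| \<le>o \<kappa>"
    using card_of_Field_ordIso[OF assms(1)] assms(2) ordIso_ordLeq_trans by blast
  then show ?thesis using card_of_image ordLeq_transitive by blast
qed

text \<open>
  Finitely many of the inequalities a i \<le> x \<le> b j are solved by the largest a i that occurs in them.
  A point x that solves them all fills the cut strictly, since \<theta> and \<sigma> have no
  last element.
\<close>

lemma no_cut_if_order_compact:
  assumes po: "partial_order_on X r" and compact: "order_compact X r \<kappa>"
    and \<theta>: "Cinfinite \<theta>" "\<theta> \<le>o \<kappa>" and \<sigma>: "Cinfinite \<sigma>" "\<sigma> \<le>o \<kappa>"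
  shows "\<not> has_cut X r \<theta> \<sigma>"
proof
  assume "has_cut X r \<theta> \<sigma>"
  then obtain a b where cut: "is_cut X r \<theta> \<sigma> a b" by (auto simp: has_cut_def)
  have a: "a i \<in> X" if "i \<in> Field \<theta>" for i using cut that by (auto simp: is_cut_def)
  have b: "b j \<in> X" if "j \<in> Field \<sigma>" for j using cut that by (auto simp: is_cut_def)
  have mono: "\<forall>(i, i')\<in>\<theta> - Id. (a i, a i') \<in> r - Id" "\<forall>(j, j')\<in>\<sigma> - Id. (b j', b j) \<in> r - Id"
    using cut by (simp_all add: is_cut_def)
  have a_less: "(a i, a i') \<in> r \<and> a i \<noteq> a i'" if "(i, i') \<in> \<theta>" "i \<noteq> i'" for i i'
    using bspec[OF mono(1), of "(i, i')"] that by auto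
  have b_less: "(b j', b j) \<in> r \<and> b j \<noteq> b j'" if "(j, j') \<in> \<sigma>" "j \<noteq> j'" for j j'
    using bspec[OF mono(2), of "(j, j')"] that by auto
  have ab: "(a i, b j) \<in> r" if "i \<in> Field \<theta>" "j \<in> Field \<sigma>" for i j
    using cut that by (auto simp: is_cut_def)
  have refl: "refl_on X r" and trans: "trans r" and antisym: "antisym r"
    using partial_order_onD[OF po] by blast+
  have Co: "Card_order \<theta>" "Card_order \<sigma>"
    and inf: "\<not> finite (Field \<theta>)" "\<not> finite (Field \<sigma>)"
    using \<theta>(1) \<sigma>(1) by (auto simp: cinfinite_def)
  have Lin: "Linear_order \<theta>"
    using Co(1) card_order_on_well_order_on well_order_on_def by blast
  have "\<exists>x\<in>X. (\<forall>y\<in>a ` Field \<theta>. (y, x) \<in> r) \<and> (\<forall>y\<in>b ` Field \<sigma>. (x, y) \<in> r)"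
  proof (rule compact[unfolded order_compact_def, rule_format], intro conjI allI impI)
    show "a ` Field \<theta> \<subseteq> X" "b ` Field \<sigma> \<subseteq> X" using a b by auto
    show "|a ` Field \<theta>| \<le>o \<kappa>" "|b ` Field \<sigma>| \<le>o \<kappa>"
      using image_Field_le Co \<theta>(2) \<sigma>(2) by blast+
    fix A' B' assume *: "finite A' \<and> A' \<subseteq> a ` Field \<theta> \<and> finite B' \<and> B' \<subseteq> b ` Field \<sigma>"
    then obtain J where J: "J \<subseteq> Field \<theta>" "finite J" "A' = a ` J"
      using finite_subset_image[of A' a] by blast
    \<comment> \<open>The index i0 covers the case that no lower bound is asked for.\<close>
    obtain i0 where "i0 \<in> Field \<theta>" using inf(1) by fastforce
    then have "\<exists>m\<in>insert i0 J. \<forall>i\<in>insert i0 J. (i, m) \<in> \<theta>"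
    proof (intro finite_chain_has_greatest)
      show "(i, j) \<in> \<theta> \<or> (j, i) \<in> \<theta>" if "i \<in> insert i0 J" "j \<in> insert i0 J" for i j
        using Lin that J(1) \<open>i0 \<in> Field \<theta>\<close>
        by (metis insert_iff linear_order_on_def partial_order_onD(1) refl_on_def subset_iff total_on_def)
      show "trans \<theta>" using Lin by (auto simp: linear_order_on_def dest: partial_order_onD)
    qed (use J in auto)
    then obtain m where m: "m \<in> Field \<theta>" "\<forall>i\<in>J. (i, m) \<in> \<theta>"
      using J(1) \<open>i0 \<in> Field \<theta>\<close> by blast
    have "(a i, a m) \<in> r" if "i \<in> J" for i
      using m that a_less[of i m] refl a[OF m(1)] by (metis refl_onD)
    then show "\<exists>x\<in>X. (\<forall>y\<in>A'. (y, x) \<in> r) \<and> (\<forall>y\<in>B'. (x, y) \<in> r)"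
      using a[OF m(1)] ab[OF m(1)] * unfolding J(3) by (intro bexI[of _ "a m"]) auto
  qed
  then obtain x where x: "x \<in> X" "\<forall>i\<in>Field \<theta>. (a i, x) \<in> r" "\<forall>j\<in>Field \<sigma>. (x, b j) \<in> r"
    by (auto simp: ball_simps)
  have "(a i, x) \<in> r - Id" if i: "i \<in> Field \<theta>" for i
  proof -
    obtain i' where "i' \<in> Field \<theta>" "i \<noteq> i'" "(i, i') \<in> \<theta>"
      using infinite_Card_order_limit[OF Co(1) inf(1) i] by blast
    then have "(a i, a i') \<in> r" "a i \<noteq> a i'" "(a i', x) \<in> r" using a_less x(2) by simp_all
    then have "a i \<noteq> x" using antisymD[OF antisym, of "a i" "a i'"] by blast
    then show ?thesis using x(2) i by simp
  qed
  moreover have "(x, b j) \<in> r - Id" if j: "j \<in> Field \<sigma>" for j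
  proof -
    obtain j' where "j' \<in> Field \<sigma>" "j \<noteq> j'" "(j, j') \<in> \<sigma>"
      using infinite_Card_order_limit[OF Co(2) inf(2) j] by blast
    then have "(b j', b j) \<in> r" "b j \<noteq> b j'" "(x, b j') \<in> r" using b_less x(3) by simp_all
    then have "x \<noteq> b j" using antisymD[OF antisym, of "b j" "b j'"] by blast
    then show ?thesis using x(3) j by simp
  qed
  ultimately have "\<exists>x\<in>X. \<forall>i\<in>Field \<theta>. \<forall>j\<in>Field \<sigma>. (a i, x) \<in> r - Id \<and> (x, b j) \<in> r - Id"
    using x(1) by (intro bexI[of _ x] ballI conjI)
  then show False
    using cut unfolding is_cut_def by (elim conjE) (rule notE)
qed

text \<open>
  A finite part of a cofinal set D of size at most \<kappa> is bounded by its greatest element, so D has an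
  upper bound x. Then x is above the whole branch, by maximality it belongs to it, and the
  branch has a last element, hence cofinality 1.
\<close>

lemma no_branch_if_order_compact:
  fixes X :: "'a set"
  assumes po: "partial_order_on X r" and compact: "order_compact X r \<kappa>"
    and B: "is_branch X r B" "has_cofinality r B \<theta>" and \<theta>: "Cinfinite \<theta>" "\<theta> \<le>o \<kappa>"
  shows False
proof -
  have BX: "B \<subseteq> X" and chain: "\<And>x y. x \<in> B \<Longrightarrow> y \<in> B \<Longrightarrow> (x, y) \<in> r \<or> (y, x) \<in> r"
    using B(1) by (auto simp: is_branch_def Chains_def)
  have refl: "refl_on X r" and trans: "trans r"
    using partial_order_onD[OF po] by blast+
  obtain D where D: "D \<subseteq> B" "\<And>x. x \<in> B \<Longrightarrow> \<exists>y\<in>D. (x, y) \<in> r" "|D| =o \<theta>"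
    using B(2) by (auto simp: has_cofinality_def cofinal_in_def)
  have inf: "\<not> finite D"
    using finite_ordLess_Cinfinite[OF \<theta>(1), of D] D(3) not_ordLess_ordIso by blast
  have "\<exists>x\<in>X. (\<forall>d\<in>D. (d, x) \<in> r) \<and> (\<forall>y\<in>{}. (x, y) \<in> r)"
  proof (rule compact[unfolded order_compact_def, rule_format], intro conjI allI impI)
    show "D \<subseteq> X" "{} \<subseteq> X" using D(1) BX by auto
    show "|D| \<le>o \<kappa>" using D(3) \<theta>(2) ordIso_ordLeq_trans by blast
    then show "|{} :: 'a set| \<le>o \<kappa>" using card_of_mono1[of "{}" D] ordLeq_transitive by blast
    fix A' B' assume *: "finite A' \<and> A' \<subseteq> D \<and> finite B' \<and> B' \<subseteq> ({} :: 'a set)"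
    obtain d where d: "d \<in> D" using inf by fastforce
    have "\<exists>m\<in>insert d A'. \<forall>x\<in>insert d A'. (x, m) \<in> r"
      using * d D(1) chain trans by (intro finite_chain_has_greatest) blast+
    then show "\<exists>x\<in>X. (\<forall>a\<in>A'. (a, x) \<in> r) \<and> (\<forall>b\<in>B'. (x, b) \<in> r)"
      using * d D(1) BX by blast
  qed
  then obtain x where x: "x \<in> X" "\<And>d. d \<in> D \<Longrightarrow> (d, x) \<in> r" by blast
  have above: "(y, x) \<in> r" if "y \<in> B" for y
    using D(2)[OF that] x(2) trans by (meson transD)
  then have "insert x B \<in> Chains r"
    using chain x(1) refl by (auto simp: Chains_def dest: refl_onD)
  then have "insert x B = B"
    using B(1) x(1) BX unfolding is_branch_def by blast
  then have "cofinal_in r B {x}"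
    using above by (auto simp: cofinal_in_def)
  then have "\<theta> \<le>o |{x}|"
    using B(2) by (simp add: has_cofinality_def)
  moreover have "|{x}| <o \<theta>" by (rule finite_ordLess_Cinfinite[OF \<theta>(1)]) simp
  ultimately show False by (meson not_ordLess_ordLeq)
qed

section \<open>Cuts and branches in the ultrapower\<close>

lemma (in struct_ultrafilter) interp_ultrapower_compact:
  assumes \<kappa>: "Cinfinite \<kappa>" and complete: "complete_on I \<kappa> E"
    and sat: "saturated Lg M (cardSuc \<kappa>)"
    and interp: "is_interp Lg M \<Gamma> cs"
    and po: "partial_order_on (int_univ M \<Gamma> cs) (int_le M \<Gamma> cs)"
  defines "ds \<equiv> map (diag I E M) cs"
  shows "partial_order_on (int_univ N \<Gamma> ds) (int_le N \<Gamma> ds)"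
    and "order_compact (int_univ N \<Gamma> ds) (int_le N \<Gamma> ds) \<kappa>"
proof -
  have ord: "tuple_order N \<Gamma> ds"
    unfolding ds_def using tuple_order_ultrapower[OF interp] tuple_order_if_partial_order[OF interp po] .
  then show "partial_order_on (int_univ N \<Gamma> ds) (int_le N \<Gamma> ds)"
    by (rule tuple_order_quotient(2))
  have "realizes_types Lg N \<kappa> 1"
    using ultrapower_realizes_types[OF \<kappa> complete saturated_imp_realizes_types[OF \<kappa> sat]] .
  then have real: "realizes_types Lg N \<kappa> (dim \<Gamma>)"
    by (rule realizes_types_tuples[OF \<kappa>])
  have "set ds \<subseteq> univ N"
    using interp diag_in_univ by (auto simp: is_interp_def ds_def)
  then show "order_compact (int_univ N \<Gamma> ds) (int_le N \<Gamma> ds) \<kappa>"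
    using interp ord by (intro order_compact_interp[OF \<kappa> real]) (simp_all add: is_interp_def ds_def)
qed


theorem claim8p1:
  fixes \<kappa> :: "'k rel"
    and I :: "'i set" and E :: "'i set set"
    and Lg :: "('f, 'r) lang"
    and M1 :: "('f, 'r, 'a) struct" and M2 :: "('f, 'r, ('i \<Rightarrow> 'a) set) struct"
    and \<Gamma>L \<Gamma>T :: "('f, 'r) interp"
    and cL cT :: "'a list" and dL dT :: "('i \<Rightarrow> 'a) set list"
  assumes "Cinfinite \<kappa>"
    and "ultrafilter_on I E" and "complete_on I \<kappa> E" and "\<not> complete_on I (cardSuc \<kappa>) E"
    and "countable_lang Lg" and "is_struct Lg M1" and "saturated Lg M1 (cardSuc \<kappa>)"
    and "interprets_linear_order Lg M1 \<Gamma>L cL"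
    and "interprets_tree Lg M1 \<Gamma>T cT"
    and "M2 = ultrapower I E M1"
    and "dL = map (diag I E M1) cL" and "dT = map (diag I E M1) cT"
  shows "\<not> has_cut (int_univ M2 \<Gamma>L dL) (int_le M2 \<Gamma>L dL) \<kappa> \<kappa>
    \<and> (\<forall>(\<theta> :: 'k rel) (\<sigma> :: 'k rel).
         Cinfinite \<theta> \<and> regularCard \<theta> \<and> \<theta> <o \<kappa> \<and>
         Cinfinite \<sigma> \<and> regularCard \<sigma> \<and> \<sigma> <o \<kappa> \<longrightarrow>
         \<not> has_cut (int_univ M2 \<Gamma>L dL) (int_le M2 \<Gamma>L dL) \<theta> \<sigma>)
    \<and> \<not> (\<exists>B (\<theta> :: 'k rel).
         is_branch (int_univ M2 \<Gamma>T dT) (int_le M2 \<Gamma>T dT) B \<and>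
         has_cofinality (int_le M2 \<Gamma>T dT) B \<theta> \<and> Cinfinite \<theta> \<and> \<theta> \<le>o \<kappa>)"
proof -
  interpret struct_ultrafilter I E Lg M1
    using assms by unfold_locales
  have L: "is_interp Lg M1 \<Gamma>L cL" "partial_order_on (int_univ M1 \<Gamma>L cL) (int_le M1 \<Gamma>L cL)"
    using assms(8) by (simp_all add: interprets_linear_order_def linear_order_on_def)
  have T: "is_interp Lg M1 \<Gamma>T cT" "partial_order_on (int_univ M1 \<Gamma>T cT) (int_le M1 \<Gamma>T cT)"
    using assms(9) by (simp_all add: interprets_tree_def tree_on_def)
  note compact = interp_ultrapower_compact[OF assms(1,3,7), folded assms(10)]
  note no_cut = no_cut_if_order_compact[OF compact[OF L, folded assms(11)]]
  note no_branch = no_branch_if_order_compact[OF compact[OF T, folded assms(12)]]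
  have "\<kappa> \<le>o \<kappa>" using assms(1) by (simp add: ordLeq_refl)
  show ?thesis
  proof (intro conjI allI impI notI)
    show False if "has_cut (int_univ M2 \<Gamma>L dL) (int_le M2 \<Gamma>L dL) \<kappa> \<kappa>"
      using no_cut[OF assms(1) \<open>\<kappa> \<le>o \<kappa>\<close> assms(1) \<open>\<kappa> \<le>o \<kappa>\<close>] that by blast
    show False if "has_cut (int_univ M2 \<Gamma>L dL) (int_le M2 \<Gamma>L dL) \<theta> \<sigma>"
      and "Cinfinite \<theta> \<and> regularCard \<theta> \<and> \<theta> <o \<kappa> \<and> Cinfinite \<sigma> \<and> regularCard \<sigma> \<and> \<sigma> <o \<kappa>"
      for \<theta> \<sigma> :: "'k rel"
      using no_cut[of \<theta> \<sigma>] that ordLess_imp_ordLeq by blast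
    show False if "\<exists>B (\<theta> :: 'k rel).
         is_branch (int_univ M2 \<Gamma>T dT) (int_le M2 \<Gamma>T dT) B \<and>
         has_cofinality (int_le M2 \<Gamma>T dT) B \<theta> \<and> Cinfinite \<theta> \<and> \<theta> \<le>o \<kappa>"
      using that no_branch by blast
  qed
qed

end
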